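(* Let $M\in\mathbb{R}$, $M\ge2$, and $a\in L^\infty(0,1)$. Let $\psi_i,\psi_j\in\mathcal H_{0,M}$ weakly solve $$-(r^{M-1}\psi')'-r^{M-1}a\,\psi=r^{M-3}\,\widehat\nu\,\psi\ \text{ in }(0,1),\qquad\psi\in\mathcal H_{0,M},$$ with $\widehat\nu=\widehat\nu_i\in\mathbb{R}$ and $\widehat\nu=\widehat\nu_j\in\mathbb{R}$, respectively. Then $$\Big(r^{M-1}(\psi_i'\psi_j-\psi_i\psi_j')\Big)'=r^{M-3}(\widehat\nu_j-\widehat\nu_i)\,\psi_i\psi_j$$ for all $r\in(0,1]$. If, in addition, $r$ is such that $\psi_j(r)\ne0$, then at that $r$ $$\Big(r^{M-1}(\psi_i'\psi_j-\psi_i\psi_j')\frac{\psi_i}{\psi_j}\Big)'=r^{M-3}(\widehat\nu_j-\widehat\nu_i)\,\psi_i^2+r^{M-1}\Big(\psi_i'-\psi_j'\frac{\psi_i}{\psi_j}\Big)^2.$$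
   Context: $H^1_{0,M}$ is the set of measurable $v:(0,1)\to\mathbb{R}$ with $\int_0^1r^{M-1}v^2dr<\infty$, having a weak derivative $v'$ with $\int_0^1r^{M-1}(v')^2dr<\infty$ (taken continuous on $(0,1]$) and with $v(1)=0$; $\mathcal H_{0,M}$ is the set of $v\in H^1_{0,M}$ with $\int_0^1r^{M-3}v^2dr<\infty$. A weak solution with parameter $\widehat\nu$ is $\psi\in\mathcal H_{0,M}$ with $\int_0^1r^{M-1}(\psi'\varphi'-a\psi\varphi)dr=\widehat\nu\int_0^1r^{M-3}\psi\varphi\,dr$ for every $\varphi\in\mathcal H_{0,M}$. Such solutions are in $C^1(0,1]$, and $\psi'$ denotes their continuous derivative; at $r=1$ derivatives are one-sided. *)

theory Defs
  imports "HOL-Analysis.Analysis"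
begin

text \<open>
  Functions on \<open>(0,1)\<close> or \<open>(0,1]\<close> are represented by total functions \<open>real \<Rightarrow> real\<close>;
  values outside the respective interval are never used.
\<close>

abbreviation I01 :: "real measure" where
  "I01 \<equiv> lebesgue_on {0<..<1}"

definition Linfty01 :: "(real \<Rightarrow> real) set" where
  "Linfty01 = {a \<in> borel_measurable I01. \<exists>C. AE r in I01. \<bar>a r\<bar> \<le> C}"

definition test_functions01 :: "(real \<Rightarrow> real) set" where
  "test_functions01 = {\<phi>. (\<forall>n. (deriv ^^ n) \<phi> differentiable_on UNIV) \<and>
     (\<exists>K. compact K \<and> K \<subseteq> {0<..<1} \<and> (\<forall>x. x \<notin> K \<longrightarrow> \<phi> x = 0))}"

definition locally_L1_01 :: "(real \<Rightarrow> real) \<Rightarrow> bool" where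
  "locally_L1_01 f \<longleftrightarrow> (\<forall>K. compact K \<and> K \<subseteq> {0<..<1} \<longrightarrow> f absolutely_integrable_on K)"

text \<open>The weak derivative is kept as a relation, since it is only determined almost everywhere.\<close>

definition has_weak_deriv01 :: "(real \<Rightarrow> real) \<Rightarrow> (real \<Rightarrow> real) \<Rightarrow> bool" where
  "has_weak_deriv01 v g \<longleftrightarrow> locally_L1_01 v \<and> locally_L1_01 g \<and>
     (\<forall>\<phi>\<in>test_functions01. (LINT r|I01. v r * deriv \<phi> r) = - (LINT r|I01. g r * \<phi> r))"

text \<open>Elements are the representatives that are continuous on \<open>(0,1]\<close>.\<close>

definition H1_0 :: "real \<Rightarrow> (real \<Rightarrow> real) set" where
  "H1_0 M = {v \<in> borel_measurable I01.
     integrable I01 (\<lambda>r. r powr (M - 1) * (v r)\<^sup>2) \<and>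
     (\<exists>g. has_weak_deriv01 v g \<and> integrable I01 (\<lambda>r. r powr (M - 1) * (g r)\<^sup>2)) \<and>
     continuous_on {0<..1} v \<and> v 1 = 0}"

definition calH_0 :: "real \<Rightarrow> (real \<Rightarrow> real) set" where
  "calH_0 M = {v \<in> H1_0 M. integrable I01 (\<lambda>r. r powr (M - 3) * (v r)\<^sup>2)}"

text \<open>
  Any two weak derivatives agree almost everywhere on \<open>(0,1)\<close>, so the integrals below do not
  depend on the choice of \<open>\<psi>'\<close> and \<open>\<phi>'\<close>.
\<close>

definition weak_solution :: "real \<Rightarrow> (real \<Rightarrow> real) \<Rightarrow> real \<Rightarrow> (real \<Rightarrow> real) \<Rightarrow> bool" where
  "weak_solution M a \<nu> \<psi> \<longleftrightarrow> \<psi> \<in> calH_0 M \<and>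
     (\<forall>\<phi>\<in>calH_0 M. \<forall>\<psi>' \<phi>'. has_weak_deriv01 \<psi> \<psi>' \<longrightarrow> has_weak_deriv01 \<phi> \<phi>' \<longrightarrow>
        (LINT r|I01. r powr (M - 1) * (\<psi>' r * \<phi>' r - a r * \<psi> r * \<phi> r))
          = \<nu> * (LINT r|I01. r powr (M - 3) * \<psi> r * \<phi> r))"

text \<open>The classical derivative on \<open>(0,1]\<close>: two-sided in the interior, one-sided at \<open>1\<close>.\<close>

definition deriv01 :: "(real \<Rightarrow> real) \<Rightarrow> real \<Rightarrow> real" where
  "deriv01 f r = vector_derivative f (at r within {0<..1})"

definition C1_on01 :: "(real \<Rightarrow> real) \<Rightarrow> bool" where
  "C1_on01 f \<longleftrightarrow>
     (\<forall>r\<in>{0<..1}. (f has_real_derivative deriv01 f r) (at r within {0<..1})) \<and>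
     continuous_on {0<..1} (deriv01 f)"

end

theory Submission
  imports Defs
begin

text \<open>
  Let \<open>\<Gamma>' = r powr (1 - M)\<close> with \<open>\<Gamma> 1 = 0\<close>. Testing the weak equation with combinations of the
  functions \<open>\<theta> s = max (\<Gamma> - \<Gamma> s) 0\<close>, for which \<open>r powr (M - 1) * \<psi>' * (\<theta> s)'\<close> is just \<open>\<psi>'\<close>
  on \<open>(s,1)\<close>, gives the Green representation \<open>\<psi> s = c * \<Gamma> s - \<integral>\<^sub>s\<^sup>1 q * (\<Gamma> - \<Gamma> s)\<close> with
  \<open>q = r powr (M - 1) * a * \<psi> + \<nu> * r powr (M - 3) * \<psi>\<close>. Hence \<open>\<psi>\<close> is continuously
  differentiable and its flux \<open>P = r powr (M - 1) * \<psi>'\<close> equals \<open>c + \<integral>\<^sub>s\<^sup>1 q\<close>. As \<open>a\<close> is only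
  bounded, \<open>P\<close> need not be differentiable at a given point \<open>x\<close>. In the Wronskian, however,
  \<open>a\<close> occurs in the integrand \<open>\<psi>\<^sub>j(x) * q\<^sub>i - \<psi>\<^sub>i(x) * q\<^sub>j\<close> only multiplied by a factor
  vanishing at \<open>x\<close>, so this integrand is continuous at \<open>x\<close> and the Wronskian is differentiable
  there. The second identity is the quotient rule.
\<close>

subsection \<open>A smooth step function\<close>

text \<open>Quantifying over some derivative, instead of iterating \<open>deriv\<close>, lets sums,
  products, reciprocals and affine substitutions be handled by induction on the order.\<close>

primrec times_differentiable :: "nat \<Rightarrow> (real \<Rightarrow> real) \<Rightarrow> bool" where
  "times_differentiable 0 f \<longleftrightarrow> True"
| "times_differentiable (Suc n) f \<longleftrightarrow>
     (\<exists>f'. (\<forall>x. (f has_real_derivative f' x) (at x)) \<and> times_differentiable n f')"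

lemma times_differentiable_SucI:
  "(\<And>x. (f has_real_derivative f' x) (at x)) \<Longrightarrow> times_differentiable n f' \<Longrightarrow>
    times_differentiable (Suc n) f"
  by auto

lemma times_differentiable_SucD: "times_differentiable (Suc n) f \<Longrightarrow> times_differentiable n f"
  by (induction n arbitrary: f) auto

lemma times_differentiable_const: "times_differentiable n (\<lambda>x. c)"
  by (induction n arbitrary: c) (auto intro!: exI[of _ "\<lambda>_. 0"])

lemma times_differentiable_add:
  "times_differentiable n f \<Longrightarrow> times_differentiable n g \<Longrightarrow> times_differentiable n (\<lambda>x. f x + g x)"
proof (induction n arbitrary: f g)
  case (Suc n)
  then obtain f' g' where
    "\<forall>x. (f has_real_derivative f' x) (at x)" "times_differentiable n f'"
    "\<forall>x. (g has_real_derivative g' x) (at x)" "times_differentiable n g'"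
    by auto
  then show ?case
    by (auto intro!: exI[of _ "\<lambda>x. f' x + g' x"] DERIV_add Suc.IH)
qed simp

lemma times_differentiable_mult:
  "times_differentiable n f \<Longrightarrow> times_differentiable n g \<Longrightarrow> times_differentiable n (\<lambda>x. f x * g x)"
proof (induction n arbitrary: f g)
  case (Suc n)
  then obtain f' g' where
    "\<forall>x. (f has_real_derivative f' x) (at x)" "times_differentiable n f'"
    "\<forall>x. (g has_real_derivative g' x) (at x)" "times_differentiable n g'"
    by auto
  moreover have "times_differentiable n f" "times_differentiable n g"
    using Suc.prems times_differentiable_SucD by blast+
  ultimately show ?case
    by (auto intro!: exI[of _ "\<lambda>x. f' x * g x + g' x * f x"] DERIV_mult
        times_differentiable_add Suc.IH)
qed simp

text \<open>The derivative \<open>- g' / g^2\<close> contains the reciprocal of \<open>g\<close>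
  itself, but only one order lower, where the induction hypothesis supplies it.\<close>

lemma times_differentiable_inverse:
  assumes "\<And>x. g x \<noteq> 0"
  shows "times_differentiable n g \<Longrightarrow> times_differentiable n (\<lambda>x. inverse (g x))"
proof (induction n)
  case (Suc n)
  then obtain g' where g': "\<forall>x. (g has_real_derivative g' x) (at x)" "times_differentiable n g'"
    by auto
  have "times_differentiable n (\<lambda>x. inverse (g x))"
    using Suc times_differentiable_SucD by blast
  then have "times_differentiable n (\<lambda>x. (-1) * (inverse (g x) * g' x * inverse (g x)))"
    by (intro times_differentiable_mult times_differentiable_const g')
  moreover have "((\<lambda>x. inverse (g x)) has_real_derivative
      (-1) * (inverse (g x) * g' x * inverse (g x))) (at x)" for x
    using DERIV_inverse'[of g "g' x" x UNIV] g' assms by simp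
  ultimately show ?case
    by (rule times_differentiable_SucI[rotated])
qed simp

lemma DERIV_affine_arg:
  assumes "\<And>x. (f has_real_derivative f' x) (at x)"
  shows "((\<lambda>x. f (c * x + d)) has_real_derivative c * f' (c * x + d)) (at x within X)"
proof -
  have "((\<lambda>x. c * x + d) has_real_derivative c) (at x within X)"
    by (auto intro!: derivative_eq_intros)
  from DERIV_chain2[OF assms this] show ?thesis
    by (simp add: mult.commute)
qed

lemma times_differentiable_affine:
  "times_differentiable n f \<Longrightarrow> times_differentiable n (\<lambda>x. f (c * x + d))"
proof (induction n arbitrary: f)
  case (Suc n)
  then obtain f' where f': "\<forall>x. (f has_real_derivative f' x) (at x)" "times_differentiable n f'"
    by auto
  have "((\<lambda>x. f (c * x + d)) has_real_derivative c * f' (c * x + d)) (at x)" for x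
    using f' by (intro DERIV_affine_arg) auto
  moreover have "times_differentiable n (\<lambda>x. c * f' (c * x + d))"
    by (intro times_differentiable_mult times_differentiable_const Suc.IH f')
  ultimately show ?case
    by (rule times_differentiable_SucI)
qed simp

lemma times_differentiable_deriv:
  assumes "times_differentiable (Suc n) f"
  shows "times_differentiable n (deriv f)" "f differentiable_on UNIV"
proof -
  obtain f' where f': "\<forall>x. (f has_real_derivative f' x) (at x)" "times_differentiable n f'"
    using assms by auto
  then have "deriv f = f'"
    by (auto intro!: ext DERIV_imp_deriv)
  then show "times_differentiable n (deriv f)"
    using f' by simp
  show "f differentiable_on UNIV"
    using f' by (auto simp: differentiable_on_def real_differentiable_def)
qed

text \<open>Leads back to the iterated \<open>deriv\<close> that occurs in
  \<open>test_functions01\<close>.\<close>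

lemma times_differentiable_imp_deriv_funpow:
  "times_differentiable (Suc n) f \<Longrightarrow> (deriv ^^ n) f differentiable_on UNIV"
proof (induction n arbitrary: f)
  case 0
  then show ?case using times_differentiable_deriv(2)[of 0 f] by simp
next
  case (Suc n)
  then show ?case
    using times_differentiable_deriv(1)[OF Suc.prems]
    by (simp add: funpow_swap1 del: times_differentiable.simps)
qed

section \<open>Functions that are flat at the origin, and the smooth step built from them\<close>

text \<open>The polynomial factor makes the family closed under differentiation;
  \<open>flat 1\<close> is the classical function \<open>exp (- 1 / x)\<close> extended by
  zero.\<close>

definition flat :: "real poly \<Rightarrow> real \<Rightarrow> real" where
  "flat p x = (if x > 0 then poly p (1 / x) * exp (- (1 / x)) else 0)"

lemma tendsto_poly_div_exp_0: "((\<lambda>u. poly p u / exp u) \<longlongrightarrow> (0::real)) at_top"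
proof -
  have "((\<lambda>u. \<Sum>i\<le>degree p. coeff p i * (u ^ i / exp u)) \<longlongrightarrow> (\<Sum>i\<le>degree p. coeff p i * 0)) at_top"
    by (intro tendsto_intros tendsto_power_div_exp_0)
  then show ?thesis
    by (simp add: poly_altdef sum_divide_distrib)
qed

text \<open>For \<open>x > 0\<close> and \<open>u = 1 / x\<close> the chain rule gives
  \<open>u^2 * (p u - p' u) * exp (- u)\<close>, and \<open>[:0, 0, 1:]\<close> is the polynomial
  \<open>u^2\<close>. Only the point 0 needs a limit argument.\<close>

lemma flat_has_real_derivative:
  "(flat p has_real_derivative flat ([:0, 0, 1:] * (p - pderiv p)) x) (at x)"
proof -
  consider "x > 0" | "x < 0" | "x = 0" by linarith
  then show ?thesis
  proof cases
    case 1
    have "((\<lambda>x. poly p (1 / x) * exp (- (1 / x))) has_real_derivative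
        flat ([:0, 0, 1:] * (p - pderiv p)) x) (at x)"
      using 1
      by (auto intro!: derivative_eq_intros DERIV_chain2[where f="poly p"] poly_DERIV
          simp: flat_def field_simps power2_eq_square)
    then show ?thesis
      by (rule has_field_derivative_transform_within_open[where S="{0<..}"])
        (use 1 in \<open>auto simp: flat_def\<close>)
  next
    case 2
    have "((\<lambda>x. 0) has_real_derivative flat ([:0, 0, 1:] * (p - pderiv p)) x) (at x)"
      using 2 by (auto simp: flat_def)
    then show ?thesis
      by (rule has_field_derivative_transform_within_open[where S="{..<0}"])
        (use 2 in \<open>auto simp: flat_def\<close>)
  next
    case 3
    \<comment> \<open>\<open>pCons 0 p\<close> is the polynomial \<open>u * p u\<close>: with
      \<open>u = 1 / y\<close> the difference quotient \<open>flat p y / y\<close> equals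
      \<open>u * p u / exp u\<close> for \<open>y > 0\<close>.\<close>
    have "((\<lambda>y. poly (pCons 0 p) (inverse y) / exp (inverse y)) \<longlongrightarrow> 0) (at_right 0)"
      by (rule filterlim_compose[OF tendsto_poly_div_exp_0 filterlim_inverse_at_top_right])
    moreover have "eventually (\<lambda>y. poly (pCons 0 p) (inverse y) / exp (inverse y) = flat p y / y)
        (at_right 0)"
      unfolding eventually_at_filter
      by (intro always_eventually) (auto simp: flat_def exp_minus field_simps)
    ultimately have "((\<lambda>y. flat p y / y) \<longlongrightarrow> 0) (at_right 0)"
      by (rule Lim_transform_eventually)
    moreover have "((\<lambda>y. flat p y / y) \<longlongrightarrow> 0) (at_left 0)"
      by (rule Lim_transform_eventually[OF tendsto_const])
        (auto simp: eventually_at_filter flat_def)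
    ultimately have "((\<lambda>y. flat p y / y) \<longlongrightarrow> 0) (at 0)"
      by (simp add: filterlim_split_at)
    then show ?thesis
      using 3 by (simp add: has_field_derivative_iff flat_def)
  qed
qed

lemma times_differentiable_flat: "times_differentiable n (flat p)"
  using flat_has_real_derivative by (induction n arbitrary: p) auto

lemma smooth_step_exists:
  obtains H :: "real \<Rightarrow> real" where
    "\<And>n. times_differentiable n H" "\<And>x. x \<le> 0 \<Longrightarrow> H x = 0" "\<And>x. x \<ge> 1 \<Longrightarrow> H x = 1"
    "\<And>x. 0 \<le> H x" "\<And>x. H x \<le> 1"
proof -
  \<comment> \<open>The step is \<open>flat 1 x / D x\<close>. At least one of \<open>x\<close> and
    \<open>1 - x\<close> is positive, so \<open>D\<close> never vanishes; \<open>1 - x\<close> is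
    written in the form of the affine substitution lemma.\<close>
  define D where "D x = flat 1 x + flat 1 ((-1) * x + 1)" for x
  have nonneg: "flat 1 x \<ge> 0" for x
    by (simp add: flat_def)
  have D_pos: "D x > 0" for x
    by (cases "x > 0") (auto simp: D_def flat_def add_pos_nonneg)
  have D_nonzero: "flat 1 x + flat 1 ((-1) * x + 1) \<noteq> 0" for x
    using D_pos[of x] by (simp add: D_def)
  show thesis
  proof
    show "times_differentiable n (\<lambda>x. flat 1 x * inverse (D x))" for n
      unfolding D_def
      by (intro times_differentiable_mult times_differentiable_inverse times_differentiable_add
          times_differentiable_flat times_differentiable_affine D_nonzero)
    show "flat 1 x * inverse (D x) = 0" if "x \<le> 0" for x
      using that by (simp add: flat_def)
    show "flat 1 x * inverse (D x) = 1" if "x \<ge> 1" for x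
      using that by (simp add: D_def flat_def)
    show "0 \<le> flat 1 x * inverse (D x)" for x
      using nonneg[of x] D_pos[of x] by simp
    show "flat 1 x * inverse (D x) \<le> 1" for x
      using nonneg[of x] D_pos[of x] nonneg[of "(-1)*x+1"]
      by (simp add: divide_inverse[symmetric] D_def)
  qed
qed

subsection \<open>Weak derivatives on the unit interval\<close>

text \<open>Passes from the Bochner integrals over \<open>(0,1)\<close> in the definitions to gauge
  integrals over compact intervals, where the fundamental theorem of calculus is available. As
  \<open>h\<close> is prescribed only on \<open>(0,1)\<close>, the choice \<open>b = 1\<close> is
  allowed.\<close>

lemma integral_I01_cutoff:
  fixes f :: "real \<Rightarrow> real"
  assumes ai: "f absolutely_integrable_on {a..b}" and ab: "0 < a" "b \<le> 1"
    and f0: "\<And>x. x \<in> {0<..<1} - {a..b} \<Longrightarrow> h x = 0"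
    and hf: "\<And>x. x \<in> {a..b} \<inter> {0<..<1} \<Longrightarrow> h x = f x"
  shows "integrable I01 h" "(LINT x|I01. h x) = integral {a..b} f"
proof -
  have "(\<lambda>x. if x \<in> {a..b} then f x else 0) absolutely_integrable_on UNIV"
    using ai absolutely_integrable_restrict_UNIV by blast
  then have "(\<lambda>x. if x \<in> {a..b} then f x else 0) absolutely_integrable_on {0<..<1}"
    by (rule set_integrable_subset) auto
  then have 1: "integrable I01 (\<lambda>x. if x \<in> {a..b} then f x else 0)"
    by (intro absolutely_integrable_imp_integrable) auto
  also have "?this \<longleftrightarrow> integrable I01 h"
    using f0 hf by (intro Bochner_Integration.integrable_cong) (auto simp: space_restrict_space)
  finally show int_h: "integrable I01 h" .
  have "(LINT x|I01. h x) = integral {0<..<1} h"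
    using int_h by (intro lebesgue_integral_eq_integral) auto
  also have "\<dots> = integral {0<..<1} (\<lambda>x. if x \<in> {a..b} then f x else 0)"
    using f0 hf by (intro integral_cong) auto
  also have "\<dots> = integral {0..1} (\<lambda>x. if x \<in> {a..b} then f x else 0)"
    using integral_open_interval_real[of 0 1 "\<lambda>x. if x \<in> {a..b} then f x else 0"] by simp
  also have "\<dots> = integral {a..b} f"
    using ab by (subst Henstock_Kurzweil_Integration.integral_restrict_Int) (auto intro!: arg_cong2[where f=integral])
  finally show "(LINT x|I01. h x) = integral {a..b} f" .
qed

text \<open>The kernels \<open>x \<mapsto> n * \<eta> (n * (x - p))\<close> have unit mass on \<open>[p, p + 1/n]\<close>.\<close>

lemma smooth_step_mollifier:
  fixes H \<eta> v :: "real \<Rightarrow> real"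
  assumes H': "\<And>x. (H has_real_derivative \<eta> x) (at x)"
    and \<eta>_cont: "continuous_on UNIV \<eta>"
    and H0: "\<And>x. x \<le> 0 \<Longrightarrow> H x = 0" and H1: "\<And>x. x \<ge> 1 \<Longrightarrow> H x = 1"
    and v_cont: "continuous_on {0<..<1} v" and p: "0 < p" "p < 1"
  shows "eventually (\<lambda>k. integrable I01 (\<lambda>x. v x * (real k * \<eta> (real k * x + - (real k * p)))))
      sequentially"
    and "(\<lambda>k. LINT x|I01. v x * (real k * \<eta> (real k * x + - (real k * p)))) \<longlonglongrightarrow> v p"
proof -
  \<comment> \<open>\<open>H\<close> is constant on each of the two open half-lines, so its
    derivative vanishes there.\<close>
  have \<eta>0: "\<eta> x = 0" if "x < 0 \<or> x > 1" for x
  proof (cases "x < 0")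
    case True
    have "(H has_real_derivative 0) (at x)"
      by (rule has_field_derivative_transform_within_open[where S="{..<0}" and f="\<lambda>_. 0"])
        (use True H0 in auto)
    then show ?thesis using H' DERIV_unique by blast
  next
    case False
    have "(H has_real_derivative 0) (at x)"
      by (rule has_field_derivative_transform_within_open[where S="{1<..}" and f="\<lambda>_. 1"])
        (use False that H1 in auto)
    then show ?thesis using H' DERIV_unique by blast
  qed
  have "bounded (\<eta> ` {0..1})"
    using \<eta>_cont by (intro compact_imp_bounded compact_continuous_image) (auto intro: continuous_on_subset)
  then obtain C where C: "C > 0" "\<And>x. x \<in> {0..1} \<Longrightarrow> \<bar>\<eta> x\<bar> \<le> C"
    by (auto simp: bounded_pos)
  define F where "F k x = v x * (real k * \<eta> (real k * x + - (real k * p)))" for k x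
  have ev: "eventually (\<lambda>k. 0 < real k \<and> inverse (real k) < d) sequentially" if "d > 0" for d
    using eventually_conj[OF eventually_gt_at_top[of 0]
        order_tendstoD(2)[OF lim_inverse_n that]]
    by eventually_elim auto
  have main: "integrable I01 (F k) \<and> (LINT x|I01. F k x) = integral {p..p + inverse (real k)} (F k) \<and>
      F k integrable_on {p..p + inverse (real k)}"
    if k: "0 < real k" "inverse (real k) < 1 - p" for k
  proof -
    let ?J = "{p..p + inverse (real k)}"
    have "continuous_on ?J (F k)"
      unfolding F_def
      by (intro continuous_intros continuous_on_subset[OF v_cont]
          continuous_on_compose2[OF \<eta>_cont]) (use k p in auto)
    then have ai: "F k absolutely_integrable_on ?J"
      by (rule absolutely_integrable_continuous_real)
    have zero: "F k x = 0" if "x \<in> {0<..<1} - ?J" for x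
    proof -
      have "real k * (x - p) < 0 \<or> real k * (x - p) > 1"
      proof (cases "x < p")
        case True
        then show ?thesis using k by (simp add: mult_pos_neg)
      next
        case False
        with that have "x - p > inverse (real k)" by auto
        then show ?thesis using k by (simp add: field_simps)
      qed
      then show ?thesis
        using \<eta>0[of "real k * x + - (real k * p)"] by (simp add: F_def algebra_simps)
    qed
    show ?thesis
      using integral_I01_cutoff[OF ai, of "F k"] zero k p ai set_lebesgue_integral_eq_integral(1)
      by auto
  qed
  show "eventually (\<lambda>k. integrable I01 (F k)) sequentially"
    using ev[of "1 - p"] p main by (auto elim!: eventually_mono simp del: of_nat_0_less_iff)
  show "(\<lambda>k. LINT x|I01. F k x) \<longlonglongrightarrow> v p"
  proof (rule tendstoI)
    fix e :: real assume e: "e > 0"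
    have "continuous (at p) v"
      using v_cont p by (simp add: continuous_on_eq_continuous_at)
    then obtain d where d: "d > 0" "\<And>x. \<bar>x - p\<bar> < d \<Longrightarrow> \<bar>v x - v p\<bar> < e / (2 * C)"
      using e C(1) unfolding continuous_at_eps_delta dist_real_def
      by (metis divide_pos_pos mult_pos_pos zero_less_numeral)
    have "eventually (\<lambda>k. 0 < real k \<and> inverse (real k) < min d (1 - p)) sequentially"
      using d p by (intro ev) auto
    then show "eventually (\<lambda>k. dist (LINT x|I01. F k x) (v p) < e) sequentially"
    proof eventually_elim
      case (elim k)
      let ?J = "{p..p + inverse (real k)}"
      have "((\<lambda>x. real k * \<eta> (real k * x + - (real k * p))) has_integral
          (H (real k * (p + inverse (real k)) + - (real k * p)) - H (real k * p + - (real k * p)))) ?J"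
      proof (rule fundamental_theorem_of_calculus[where f="\<lambda>x. H (real k * x + - (real k * p))"])
        fix x
        show "((\<lambda>x. H (real k * x + - (real k * p))) has_vector_derivative
            real k * \<eta> (real k * x + - (real k * p))) (at x within ?J)"
          unfolding has_real_derivative_iff_has_vector_derivative[symmetric]
          by (rule DERIV_affine_arg[OF H'])
      qed (use elim in auto)
      moreover have "real k * (p + inverse (real k)) + - (real k * p) = 1" "real k * p + - (real k * p) = 0"
        using elim by (auto simp: field_simps)
      ultimately have "((\<lambda>x. real k * \<eta> (real k * x + - (real k * p))) has_integral 1) ?J"
        by (simp only: H0[OF order_refl] H1[OF order_refl] diff_zero)
      from has_integral_mult_right[OF this, of "v p"]
      have 1: "((\<lambda>x. v p * (real k * \<eta> (real k * x + - (real k * p)))) has_integral v p) ?J"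
        by simp
      have 2: "(F k has_integral (LINT x|I01. F k x)) ?J"
        using main[of k] elim by (auto simp: has_integral_iff)
      \<comment> \<open>Oscillation of \<open>v\<close> at most \<open>e / (2 * C)\<close>, kernel
        height at most \<open>k * C\<close>, interval length \<open>1 / k\<close>: the product is
        \<open>e / 2\<close>.\<close>
      have "norm ((LINT x|I01. F k x) - v p) \<le> e / (2 * C) * (real k * C) * measure lborel {p..p + inverse (real k)}"
      proof (rule has_integral_bound_real[OF _ finite.emptyI has_integral_diff[OF 2 1]])
        fix x assume x: "x \<in> ?J - {}"
        then have "0 \<le> real k * (x - p)" "real k * (x - p) \<le> 1"
          using elim by (auto simp: field_simps)
        then have A: "\<bar>\<eta> (real k * x + - (real k * p))\<bar> \<le> C"
          by (intro C) (auto simp: algebra_simps)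
        have B: "\<bar>v x - v p\<bar> \<le> e / (2 * C)"
          using x elim by (intro less_imp_le d) auto
        have "\<bar>v x - v p\<bar> * (real k * \<bar>\<eta> (real k * x + - (real k * p))\<bar>) \<le> e / (2 * C) * (real k * C)"
          by (intro mult_mono A B) (use e C in auto)
        moreover have "F k x - v p * (real k * \<eta> (real k * x + - (real k * p))) =
            (v x - v p) * (real k * \<eta> (real k * x + - (real k * p)))"
          by (simp add: F_def algebra_simps)
        ultimately show "norm (F k x - v p * (real k * \<eta> (real k * x + - (real k * p))))
            \<le> e / (2 * C) * (real k * C)"
          by (simp only: real_norm_def abs_mult abs_of_nat)
      qed (use e C in auto)
      also have "\<dots> = e / 2"
        using C elim by (simp add: field_simps)
      finally show ?case
        using e by (simp add: dist_norm)
    qed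
  qed
qed

text \<open>The difference of smooth steps at \<open>s\<close> and \<open>t\<close> is a test
  function approximating the indicator of \<open>(s,t]\<close>, and its derivative is a difference
  of mollifiers at \<open>s\<close> and \<open>t\<close>. In the limit the defining identity of the
  weak derivative becomes \<open>v s - v t = - integral {s..t} g\<close>.\<close>

lemma weak_deriv_FTC:
  assumes wd: "has_weak_deriv01 v g" and v_cont: "continuous_on {0<..<1} v"
    and st: "0 < s" "s < t" "t < 1"
  shows "v t - v s = integral {s..t} g"
proof -
  obtain H :: "real \<Rightarrow> real" where smooth: "\<And>n. times_differentiable n H"
    and H0: "\<And>x. x \<le> 0 \<Longrightarrow> H x = 0" and H1: "\<And>x. x \<ge> 1 \<Longrightarrow> H x = 1"
    and H_bd: "\<And>x. 0 \<le> H x" "\<And>x. H x \<le> 1"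
    using smooth_step_exists by metis
  obtain \<eta> \<eta>' where H': "\<And>x. (H has_real_derivative \<eta> x) (at x)"
    and \<eta>': "\<And>x. (\<eta> has_real_derivative \<eta>' x) (at x)"
    using smooth[of "Suc (Suc 0)"] by auto
  have \<eta>_cont: "continuous_on UNIV \<eta>"
    by (rule DERIV_continuous_on[of _ \<eta> \<eta>']) (use \<eta>' in simp)
  define \<phi> where "\<phi> k x = H (real k * x + - (real k * s)) + (-1) * H (real k * x + - (real k * t))" for k x
  \<comment> \<open>Leaves room for the step at \<open>t\<close>, which has width
    \<open>1 / k\<close>, to end before 1, so that the support stays in the compact set
    \<open>[s, t + d]\<close> inside \<open>(0,1)\<close>.\<close>
  define d where "d = (1 - t) / 2"
  have d: "d > 0" "t + d < 1" using st by (auto simp: d_def field_simps)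
  have "eventually (\<lambda>k. 0 < real k \<and> inverse (real k) < d) sequentially"
    using eventually_conj[OF eventually_gt_at_top[of 0] order_tendstoD(2)[OF lim_inverse_n d(1)]]
    by eventually_elim auto
  then obtain N where N: "\<And>k. k \<ge> N \<Longrightarrow> 0 < real k \<and> inverse (real k) < d"
    by (auto simp: eventually_sequentially)
  have \<phi>0: "\<phi> k x = 0" if "x \<notin> {s..t + d}" "k \<ge> N" for k x
  proof (cases "x < s")
    case True
    then have "real k * x \<le> real k * s" "real k * x \<le> real k * t"
      using st by (auto intro!: mult_left_mono)
    then show ?thesis by (simp add: \<phi>_def H0)
  next
    case False
    then have x: "x - t > d" "x - s > d" using that st by auto
    have "inverse (real k) < x - t" "inverse (real k) < x - s" "0 < real k"
      using N[of k] x that by auto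
    then have "1 \<le> real k * x + - (real k * t)" "1 \<le> real k * x + - (real k * s)"
      by (auto simp: field_simps)
    then show ?thesis by (simp add: \<phi>_def H1)
  qed
  have \<phi>_smooth: "times_differentiable n (\<phi> k)" for n k
    unfolding \<phi>_def
    by (intro times_differentiable_add times_differentiable_mult times_differentiable_const
        times_differentiable_affine smooth)
  have \<phi>_test: "\<phi> k \<in> test_functions01" if "k \<ge> N" for k
    unfolding test_functions01_def
    using \<phi>0 that times_differentiable_imp_deriv_funpow[OF \<phi>_smooth] st d
    by (auto intro!: exI[of _ "{s..t + d}"])
  have \<phi>_deriv: "deriv (\<phi> k) x =
      real k * \<eta> (real k * x + - (real k * s)) - real k * \<eta> (real k * x + - (real k * t))" for k x
    unfolding \<phi>_def
    using DERIV_diff[OF DERIV_affine_arg[of H \<eta> "real k" "- (real k * s)" x UNIV, OF H']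
        DERIV_affine_arg[of H \<eta> "real k" "- (real k * t)" x UNIV, OF H']]
    by (auto intro!: DERIV_imp_deriv)
  let ?K = "\<lambda>p k x. v x * (real k * \<eta> (real k * x + - (real k * p)))"
  have moll: "eventually (\<lambda>k. integrable I01 (?K p k)) sequentially"
    "(\<lambda>k. LINT x|I01. ?K p k x) \<longlonglongrightarrow> v p" if "0 < p" "p < 1" for p
    using smooth_step_mollifier[of H \<eta> v p] H' \<eta>_cont H0 H1 v_cont that by blast+
  have s1: "s < 1" and t0: "0 < t" using st by auto
  have "eventually (\<lambda>k. (LINT x|I01. g x * \<phi> k x) = (LINT x|I01. ?K t k x) - (LINT x|I01. ?K s k x))
      sequentially"
    using moll(1)[OF \<open>0 < s\<close> s1] moll(1)[OF t0 \<open>t < 1\<close>] eventually_ge_at_top[of N]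
  proof eventually_elim
    case (elim k)
    then have i: "integrable I01 (?K s k)" "integrable I01 (?K t k)"
      by auto
    have "(LINT x|I01. g x * \<phi> k x) = - (LINT x|I01. v x * deriv (\<phi> k) x)"
      using wd \<phi>_test elim by (auto simp: has_weak_deriv01_def)
    also have "(LINT x|I01. v x * deriv (\<phi> k) x) = (LINT x|I01. ?K s k x - ?K t k x)"
      by (simp add: \<phi>_deriv algebra_simps)
    also have "\<dots> = (LINT x|I01. ?K s k x) - (LINT x|I01. ?K t k x)"
      using i by (rule Bochner_Integration.integral_diff)
    finally show ?case by simp
  qed
  moreover have "(\<lambda>k. (LINT x|I01. ?K t k x) - (LINT x|I01. ?K s k x)) \<longlonglongrightarrow> v t - v s"
    using st by (intro tendsto_diff moll(2)) auto
  ultimately have lim1: "(\<lambda>k. LINT x|I01. g x * \<phi> k x) \<longlonglongrightarrow> v t - v s"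
    by (rule tendsto_cong[THEN iffD2])
  have "{s..t + d} \<subseteq> {0<..<1}"
    using st d by auto
  then have g_ai: "g absolutely_integrable_on {s..t + d}"
    using wd compact_Icc unfolding has_weak_deriv01_def locally_L1_01_def by blast
  have \<phi>_cont: "continuous_on X (\<phi> k)" for X k
    using times_differentiable_imp_deriv_funpow[OF \<phi>_smooth, of 0 k]
    by (auto intro: continuous_on_subset differentiable_imp_continuous_on)
  have \<phi>_bd: "\<bar>\<phi> k x\<bar> \<le> 1" for k x
    using H_bd[of "real k * x + - (real k * s)"] H_bd[of "real k * x + - (real k * t)"]
    by (auto simp: \<phi>_def)
  have g\<phi>_ai: "(\<lambda>x. \<phi> k x * g x) absolutely_integrable_on {s..t + d}" for k
    using \<phi>_bd g_ai
    by (intro absolutely_integrable_bounded_measurable_product_real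
        continuous_imp_measurable_on_sets_lebesgue \<phi>_cont)
      (auto simp: bounded_iff)
  \<comment> \<open>The interval is half-open because \<open>H 0 = 0\<close>: the step at
    \<open>p\<close> tends to 0 at \<open>p\<close> itself. The missing endpoint \<open>s\<close> is
    a null set and is restored at the end.\<close>
  let ?G = "\<lambda>x. if x \<in> {s<..t} then g x else 0"
  have step: "(\<lambda>k. H (real (k + N) * x + - (real (k + N) * p))) \<longlonglongrightarrow> (if x \<le> p then 0 else 1)" for x p
  proof (cases "x \<le> p")
    case True
    then show ?thesis
      using H0[of "real (_ + N) * x + - (real (_ + N) * p)"] by (simp add: mult_left_mono)
  next
    case False
    have "eventually (\<lambda>k. inverse (real k) < x - p \<and> 0 < real k) sequentially"
      using eventually_conj[OF order_tendstoD(2)[OF lim_inverse_n, of "x - p"]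
          eventually_gt_at_top[of 0]] False
      by (auto elim!: eventually_mono)
    then have "eventually (\<lambda>k. H (real k * x + - (real k * p)) = 1) sequentially"
      by eventually_elim (auto intro!: H1 simp: field_simps)
    then have "(\<lambda>k. H (real k * x + - (real k * p))) \<longlonglongrightarrow> 1"
      by (rule tendsto_eventually)
    from LIMSEQ_ignore_initial_segment[OF this, of N] False show ?thesis
      by (simp only: if_False)
  qed
  \<comment> \<open>Dominated convergence with majorant \<open>\<bar>g\<bar>\<close>. The shift by
    \<open>N\<close> puts the support of every member of the sequence into
    \<open>[s, t + d]\<close>.\<close>
  have "(\<lambda>k. integral {s..t + d} (\<lambda>x. \<phi> (k + N) x * g x)) \<longlonglongrightarrow> integral {s..t + d} ?G"
  proof (rule dominated_convergence(2))
    show "(\<lambda>x. \<phi> (k + N) x * g x) integrable_on {s..t + d}" for k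
      using g\<phi>_ai set_lebesgue_integral_eq_integral(1) by blast
    show "(\<lambda>x. \<bar>g x\<bar>) integrable_on {s..t + d}"
      using g_ai by (auto simp: absolutely_integrable_on_def)
    show "norm (\<phi> (k + N) x * g x) \<le> \<bar>g x\<bar>" for k x
      using \<phi>_bd[of "k + N" x] by (simp add: abs_mult mult_left_le_one_le)
    have "(\<lambda>k. \<phi> (k + N) x * g x) \<longlonglongrightarrow>
        ((if x \<le> s then 0 else 1) + (-1) * (if x \<le> t then 0 else 1)) * g x" for x
      unfolding \<phi>_def by (intro tendsto_intros step)
    moreover have "((if x \<le> s then 0 else 1) + (-1) * (if x \<le> t then 0 else 1)) * g x = ?G x" for x
      using st by auto
    ultimately show "(\<lambda>k. \<phi> (k + N) x * g x) \<longlonglongrightarrow> ?G x" for x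
      by simp
  qed
  also have "(\<lambda>k. integral {s..t + d} (\<lambda>x. \<phi> (k + N) x * g x)) = (\<lambda>k. LINT x|I01. g x * \<phi> (k + N) x)"
  proof
    fix k
    show "integral {s..t + d} (\<lambda>x. \<phi> (k + N) x * g x) = (LINT x|I01. g x * \<phi> (k + N) x)"
      using st d \<phi>0[of _ "k + N"]
      by (intro integral_I01_cutoff(2)[OF g\<phi>_ai, symmetric]) auto
  qed
  finally have "(\<lambda>k. LINT x|I01. g x * \<phi> (k + N) x) \<longlonglongrightarrow> integral {s..t + d} ?G" .
  with LIMSEQ_ignore_initial_segment[OF lim1, of N] have "v t - v s = integral {s..t + d} ?G"
    using LIMSEQ_unique by blast
  also have "\<dots> = integral {s..t + d} (\<lambda>x. if x \<in> {s..t} then g x else 0)"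
    by (rule integral_spike[of "{s}"]) auto
  also have "\<dots> = integral {s..t} g"
    using d by (subst Henstock_Kurzweil_Integration.integral_restrict_Int) (auto intro!: arg_cong2[where f=integral])
  finally show ?thesis .
qed

section \<open>Weak derivatives of piecewise differentiable functions, and their
  measurability\<close>

lemma integral_I01_eq:
  fixes f :: "real \<Rightarrow> real"
  assumes "f absolutely_integrable_on {0..1}"
  shows "integrable I01 f" "(LINT x|I01. f x) = integral {0..1} f"
proof -
  have "f absolutely_integrable_on {0<..<1}"
    using assms by (rule set_integrable_subset) auto
  then show "integrable I01 f"
    by (intro absolutely_integrable_imp_integrable) auto
  then show "(LINT x|I01. f x) = integral {0..1} f"
    by (simp add: lebesgue_integral_eq_integral integral_open_interval_real)
qed

lemma continuous_on_test_function:
  assumes "\<phi> \<in> test_functions01"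
  shows "continuous_on X \<phi>" "continuous_on X (deriv \<phi>)"
    "(\<phi> has_real_derivative deriv \<phi> x) (at x)" "\<phi> 0 = 0" "\<phi> 1 = 0"
proof -
  have diff: "(deriv ^^ n) \<phi> differentiable_on UNIV" for n
    using assms by (auto simp: test_functions01_def)
  show "continuous_on X \<phi>" "continuous_on X (deriv \<phi>)"
    using diff[of 0] diff[of 1]
    by (auto intro: continuous_on_subset differentiable_imp_continuous_on)
  show "(\<phi> has_real_derivative deriv \<phi> x) (at x)"
    using diff[of 0]
    by (simp add: differentiable_on_def real_differentiable_def)
      (metis DERIV_imp_deriv)
  show "\<phi> 0 = 0" "\<phi> 1 = 0"
    using assms by (fastforce simp: test_functions01_def)+
qed

text \<open>Integration by parts: the fundamental theorem for the continuous product
  \<open>f * \<phi>\<close> tolerates finitely many exceptional points, and the boundary terms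
  vanish with \<open>\<phi>\<close>.\<close>

lemma has_weak_deriv01_piecewise:
  assumes f: "continuous_on {0..1} f" and S: "finite S"
    and f': "\<And>x. x \<in> {0<..<1} - S \<Longrightarrow> (f has_real_derivative f' x) (at x)"
    and f'_ai: "f' absolutely_integrable_on {0..1}"
  shows "has_weak_deriv01 f f'"
proof -
  have local: "locally_L1_01 h" if "h absolutely_integrable_on {0..1}" for h
    unfolding locally_L1_01_def
  proof safe
    fix K :: "real set" assume "compact K" "K \<subseteq> {0<..<1}"
    then show "h absolutely_integrable_on K"
      using lmeasurable_compact[of K] by (intro set_integrable_subset[OF that]) (auto simp: subset_iff)
  qed
  have "(LINT r|I01. f r * deriv \<phi> r) = - (LINT r|I01. f' r * \<phi> r)"
    if \<phi>: "\<phi> \<in> test_functions01" for \<phi>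
  proof -
    note [continuous_intros] = continuous_on_test_function(1,2)[OF \<phi>]
    have 1: "(\<lambda>r. f r * deriv \<phi> r) absolutely_integrable_on {0..1}"
      by (intro absolutely_integrable_continuous_real continuous_intros f)
    have "(\<lambda>r. \<phi> r * f' r) absolutely_integrable_on {0..1}"
      by (intro absolutely_integrable_bounded_measurable_product_real f'_ai
          continuous_imp_measurable_on_sets_lebesgue compact_imp_bounded
          compact_continuous_image continuous_intros) auto
    then have 2: "(\<lambda>r. f' r * \<phi> r) absolutely_integrable_on {0..1}"
      by (simp add: mult.commute)
    have "((\<lambda>r. f r * deriv \<phi> r + f' r * \<phi> r) has_integral (f 1 * \<phi> 1 - f 0 * \<phi> 0)) {0..1}"
    proof (rule fundamental_theorem_of_calculus_interior_strong[OF S])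
      show "continuous_on {0..1} (\<lambda>r. f r * \<phi> r)"
        by (intro continuous_intros f)
      fix x assume "x \<in> {0<..<1} - S"
      then show "((\<lambda>r. f r * \<phi> r) has_vector_derivative f x * deriv \<phi> x + f' x * \<phi> x) (at x)"
        using DERIV_mult[OF f' continuous_on_test_function(3)[OF \<phi>], of x]
        by (simp add: has_real_derivative_iff_has_vector_derivative algebra_simps)
    qed simp
    then have "integral {0..1} (\<lambda>r. f r * deriv \<phi> r + f' r * \<phi> r) = 0"
      using continuous_on_test_function(4,5)[OF \<phi>] by (simp add: has_integral_iff)
    moreover have "integral {0..1} (\<lambda>r. f r * deriv \<phi> r + f' r * \<phi> r) =
        integral {0..1} (\<lambda>r. f r * deriv \<phi> r) + integral {0..1} (\<lambda>r. f' r * \<phi> r)"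
      using 1 2 by (intro Henstock_Kurzweil_Integration.integral_add set_lebesgue_integral_eq_integral(1))
    ultimately show ?thesis
      using integral_I01_eq(2)[OF 1] integral_I01_eq(2)[OF 2] by simp
  qed
  then show ?thesis
    using local f'_ai absolutely_integrable_continuous_real[OF f]
    by (auto simp: has_weak_deriv01_def)
qed

text \<open>\<open>g\<close> is the pointwise limit of its restrictions to compact intervals
  exhausting \<open>(0,1)\<close>; the summand 2 keeps these intervals nonempty from
  \<open>n = 0\<close> on.\<close>

lemma locally_L1_01_measurable:
  assumes "locally_L1_01 g"
  shows "g \<in> borel_measurable I01"
proof (rule borel_measurable_LIMSEQ_real)
  let ?K = "\<lambda>n. {inverse (real n + 2)..1 - inverse (real n + 2)}"
  show "(\<lambda>x. if x \<in> ?K n then g x else 0) \<in> borel_measurable I01" for n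
  proof -
    have "0 < inverse (real n + 2)" by simp
    then have "?K n \<subseteq> {0<..<1}" by (auto simp del: inverse_positive_iff_positive)
    then have "g absolutely_integrable_on ?K n"
      using assms compact_Icc unfolding locally_L1_01_def by blast
    then have "(\<lambda>x. if x \<in> ?K n then g x else 0) \<in> borel_measurable lebesgue"
      by (intro borel_measurable_if_I) (auto dest: absolutely_integrable_imp_borel_measurable)
    then show ?thesis
      by (rule measurable_restrict_space1)
  qed
  fix x assume "x \<in> space I01"
  then have x: "0 < x" "x < 1"
    by (auto simp: space_restrict_space)
  have "(\<lambda>n. inverse (real n + 2)) \<longlonglongrightarrow> 0"
    using LIMSEQ_ignore_initial_segment[OF lim_inverse_n, of 2] by (simp add: add.commute)
  then have "eventually (\<lambda>n. inverse (real n + 2) < min x (1 - x)) sequentially"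
    using x by (intro order_tendstoD(2)) auto
  then have "eventually (\<lambda>n. (if x \<in> ?K n then g x else 0) = g x) sequentially"
    by eventually_elim auto
  then show "(\<lambda>n. if x \<in> ?K n then g x else 0) \<longlonglongrightarrow> g x"
    by (rule tendsto_eventually)
qed

subsection \<open>Bounded measurable functions\<close>

text \<open>Unlike integrability, this property passes to products, and it holds for all coefficient
  and weight factors on intervals \<open>[m,1]\<close> with \<open>m > 0\<close>.\<close>

definition bdd_measurable_on :: "real set \<Rightarrow> (real \<Rightarrow> real) \<Rightarrow> bool" where
  "bdd_measurable_on S f \<longleftrightarrow> f \<in> borel_measurable (lebesgue_on S) \<and> bounded (f ` S)"

lemma bdd_measurable_on_continuous:
  "continuous_on {a..b} f \<Longrightarrow> bdd_measurable_on {a..b} f"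
  unfolding bdd_measurable_on_def
  by (intro conjI continuous_imp_measurable_on_sets_lebesgue compact_imp_bounded
      compact_continuous_image) auto

lemma bdd_measurable_on_mult:
  assumes "bdd_measurable_on S f" "bdd_measurable_on S g"
  shows "bdd_measurable_on S (\<lambda>x. f x * g x)"
proof -
  obtain A B where "\<And>x. x \<in> S \<Longrightarrow> \<bar>f x\<bar> \<le> A" "\<And>x. x \<in> S \<Longrightarrow> \<bar>g x\<bar> \<le> B"
    using assms by (auto simp: bdd_measurable_on_def bounded_iff)
  then have "\<bar>f x * g x\<bar> \<le> \<bar>A\<bar> * \<bar>B\<bar>" if "x \<in> S" for x
    unfolding abs_mult using that by (intro mult_mono) (auto intro: order_trans[OF _ abs_ge_self])
  then show ?thesis
    using assms by (auto simp: bdd_measurable_on_def bounded_iff)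
qed

lemma bdd_measurable_on_add:
  assumes "bdd_measurable_on S f" "bdd_measurable_on S g"
  shows "bdd_measurable_on S (\<lambda>x. f x + g x)"
  using assms bounded_plus_comp[of f S g] by (auto simp: bdd_measurable_on_def)

lemma bdd_measurable_on_cutoff:
  assumes "bdd_measurable_on S f"
  shows "bdd_measurable_on S (\<lambda>x. if x < c then 0 else f x)"
proof -
  have "(\<lambda>x. if x < c then 0 else f x) = (\<lambda>x. indicator {c..} x * f x)"
    by (auto simp: indicator_def fun_eq_iff)
  moreover have "bdd_measurable_on S (indicator {c..})"
  proof -
    have "indicat_real {c..} \<in> borel_measurable lebesgue"
      by (intro borel_measurable_indicator) auto
    then show ?thesis
      by (auto simp: bdd_measurable_on_def bounded_iff indicator_def measurable_restrict_space1
          intro!: exI[of _ 1])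
  qed
  ultimately show ?thesis
    using assms bdd_measurable_on_mult by simp
qed

lemma bdd_measurable_on_absolutely_integrable:
  assumes "bdd_measurable_on {a..b} f"
  shows "f absolutely_integrable_on {a..b}"
  using absolutely_integrable_bounded_measurable_product_real[of f "{a..b}" "\<lambda>_. 1"] assms
    absolutely_integrable_continuous_real[of a b "\<lambda>_. 1"]
  by (auto simp: bdd_measurable_on_def)

lemma bdd_measurable_on_subset:
  assumes "bdd_measurable_on S f" "T \<subseteq> S" "T \<in> sets lebesgue"
  shows "bdd_measurable_on T f"
  using assms bounded_subset[OF _ image_mono[OF assms(2)]] measurable_restrict_mono[OF _ assms(2)]
  by (auto simp: bdd_measurable_on_def)

subsection \<open>Derivatives at points of continuity\<close>

text \<open>Differentiability at \<open>x\<close> is local, so it can be studied on a compact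
  interval away from the singularity of the weights at 0. For \<open>x = 1\<close> both filters are
  one-sided.\<close>

lemma at_within_01_eq:
  assumes "0 < m" "m < x" "x \<le> 1"
  shows "at x within {0<..1::real} = at x within {m..1}"
  by (rule at_within_nhd[of _ "{m<..}"]) (use assms in auto)

text \<open>The fundamental theorem at a single point of continuity; the minus sign comes from
  differentiating in the lower limit.\<close>

lemma integral_upper_has_real_derivative:
  fixes f :: "real \<Rightarrow> real"
  assumes m: "0 < m" "m < x" "x \<le> 1" and f: "f integrable_on {m..1}"
    and cont: "continuous (at x within {m..1}) f"
  shows "((\<lambda>s. integral {s..1} f) has_real_derivative - f x) (at x within {0<..1})"
proof -
  have "((\<lambda>s. integral {m..s} f) has_vector_derivative f x) (at x within {m..1} - {})"
    using m cont by (intro integral_has_vector_derivative_continuous_at f) auto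
  then have "((\<lambda>s. integral {m..1} f - integral {m..s} f) has_real_derivative 0 - f x)
      (at x within {m..1})"
    by (intro derivative_intros) (simp add: has_real_derivative_iff_has_vector_derivative)
  then have "((\<lambda>s. integral {s..1} f) has_real_derivative 0 - f x) (at x within {m..1})"
  proof (rule has_field_derivative_transform_within[OF _ zero_less_one])
    fix s assume "s \<in> {m..1}"
    then show "integral {m..1} f - integral {m..s} f = integral {s..1} f"
      using Henstock_Kurzweil_Integration.integral_combine[of m s 1 f] f by auto
  qed (use m in auto)
  then show ?thesis
    using m by (simp add: at_within_01_eq)
qed

text \<open>Since \<open>f x = 0\<close>, the difference quotient of the product is that of
  \<open>f\<close> times \<open>g s\<close>, so continuity of \<open>g\<close> at \<open>x\<close>
  suffices. This serves for factors such as the flux that may fail to be differentiable.\<close>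

lemma has_real_derivative_mult_vanishing:
  fixes f g :: "real \<Rightarrow> real"
  assumes f: "(f has_real_derivative D) (at x within S)" and "f x = 0"
    and g: "continuous (at x within S) g"
  shows "((\<lambda>s. f s * g s) has_real_derivative D * g x) (at x within S)"
proof -
  have "((\<lambda>s. (f s - f x) / (s - x) * g s) \<longlongrightarrow> D * g x) (at x within S)"
    using f g by (intro tendsto_mult) (auto simp: has_field_derivative_iff continuous_within)
  then show ?thesis
    using \<open>f x = 0\<close> by (simp add: has_field_derivative_iff)
qed

text \<open>A bounded factor, possibly discontinuous like \<open>a\<close>, cannot spoil the limit 0
  of the other factor.\<close>

lemma continuous_bounded_mult_vanishing:
  fixes f g :: "real \<Rightarrow> real"
  assumes "\<And>s. s \<in> S \<Longrightarrow> \<bar>f s\<bar> \<le> B" and "g x = 0" and "continuous (at x within S) g"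
  shows "continuous (at x within S) (\<lambda>s. f s * g s)"
proof -
  have "((\<lambda>s. f s * g s) \<longlongrightarrow> 0) (at x within S)"
    using assms
    by (intro lim_null_mult_left_bounded[of f B])
      (auto simp: continuous_within eventually_at_filter intro!: always_eventually)
  then show ?thesis
    using assms by (simp add: continuous_within)
qed

text \<open>Derivatives within a set are unique at its limit points, and every \<open>r\<close> in
  \<open>(0,1]\<close> is a limit point of \<open>(0,1]\<close>.\<close>

lemma deriv01_eqI:
  assumes "(f has_real_derivative D) (at r within {0<..1})" "r \<in> {0<..1}"
  shows "deriv01 f r = D"
proof -
  have "at r within {0<..1} \<noteq> bot"
    using assms(2) by (simp add: at_within_01_eq[of "r / 2"] trivial_limit_within islimpt_Icc)
  then show ?thesis
    using assms(1) unfolding deriv01_def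
    by (intro vector_derivative_within) (auto simp: has_real_derivative_iff_has_vector_derivative)
qed

lemma integral_I01_bdd_measurable:
  assumes "bdd_measurable_on {m..1} f" "0 < m"
    and "\<And>x. 0 < x \<Longrightarrow> x < m \<Longrightarrow> h x = 0" and "\<And>x. m \<le> x \<Longrightarrow> x < 1 \<Longrightarrow> h x = f x"
  shows "integrable I01 h" "(LINT x|I01. h x) = integral {m..1} f"
proof -
  note cutoff = integral_I01_cutoff[OF bdd_measurable_on_absolutely_integrable[OF assms(1)] assms(2) order_refl]
  show "integrable I01 h" "(LINT x|I01. h x) = integral {m..1} f"
    by (rule cutoff; use assms(3,4) in force)+
qed

subsection \<open>Hinge test functions\<close>

text \<open>For increasing \<open>\<Gamma>\<close> this is
  \<open>max (\<Gamma> r - \<Gamma> s) 0\<close> on \<open>r > 0\<close>. Branching on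
  \<open>r \<le> s\<close> gives the value 0 at \<open>r = 0\<close> too, where nothing is known
  about \<open>\<Gamma>\<close>.\<close>

definition hinge :: "(real \<Rightarrow> real) \<Rightarrow> real \<Rightarrow> real \<Rightarrow> real" where
  "hinge \<Gamma> s r = (if r \<le> s then 0 else \<Gamma> r - \<Gamma> s)"

context
  fixes M :: real and \<Gamma> :: "real \<Rightarrow> real"
  assumes \<Gamma>_deriv: "\<And>r. r > 0 \<Longrightarrow> (\<Gamma> has_real_derivative r powr (1 - M)) (at r)"
begin

lemma continuous_on_\<Gamma>: "X \<subseteq> {0<..} \<Longrightarrow> continuous_on X \<Gamma>"
  using \<Gamma>_deriv by (intro DERIV_continuous_on[of _ _ "\<lambda>r. r powr (1 - M)"])
    (auto intro: has_field_derivative_at_within)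

lemma continuous_on_hinge:
  assumes "0 < s"
  shows "continuous_on {0..1} (hinge \<Gamma> s)"
proof -
  have "continuous_on {0..1} (\<lambda>r. if r \<le> s then 0 else \<Gamma> r - \<Gamma> s)"
    using assms by (intro continuous_on_cases_le continuous_intros continuous_on_\<Gamma>) auto
  then show ?thesis
    by (simp add: hinge_def[abs_def])
qed

text \<open>A single hinge has the value \<open>- \<Gamma> s\<close> at 1 and violates the boundary
  condition; subtracting \<open>k\<close> times a second hinge repairs this. Near 0 the combination
  vanishes, so every power weight is harmless.\<close>

lemma hinge_difference_in_calH_0:
  assumes \<Gamma>_1: "\<Gamma> 1 = 0" and s: "0 < s" "s < 1" and h: "0 < h" "h < 1" and k: "k * \<Gamma> h = \<Gamma> s"
  defines "\<phi> \<equiv> \<lambda>r. hinge \<Gamma> s r - k * hinge \<Gamma> h r"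
    and "\<phi>' \<equiv> \<lambda>r. (if r < s then 0 else r powr (1 - M)) - k * (if r < h then 0 else r powr (1 - M))"
  shows "has_weak_deriv01 \<phi> \<phi>'" "\<phi> \<in> calH_0 M"
proof -
  define m where "m = min s h"
  have m: "0 < m" "m < 1" "m \<le> s" "m \<le> h" using s h by (auto simp: m_def)
  have \<phi>_cont: "continuous_on {0..1} \<phi>"
    unfolding \<phi>_def by (intro continuous_intros continuous_on_hinge s h)
  have hinge': "bdd_measurable_on {0..1} (\<lambda>r. if r < p then 0 else r powr (1 - M))" if "0 < p" for p
  proof -
    \<comment> \<open>Replacing \<open>r\<close> by \<open>max r p\<close> makes the power
      continuous on all of \<open>[0,1]\<close> and changes nothing where the cutoff is
      inactive.\<close>
    have "bdd_measurable_on {0..1} (\<lambda>r. if r < p then 0 else max r p powr (1 - M))"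
      using that by (intro bdd_measurable_on_cutoff bdd_measurable_on_continuous continuous_intros) auto
    also have "(\<lambda>r. if r < p then 0 else max r p powr (1 - M)) = (\<lambda>r. if r < p then 0 else r powr (1 - M))"
      by (auto simp: fun_eq_iff)
    finally show ?thesis .
  qed
  have const: "bdd_measurable_on {0..1} (\<lambda>_. c)" for c
    by (intro bdd_measurable_on_continuous continuous_intros)
  have \<phi>'_bm: "bdd_measurable_on {0..1} \<phi>'"
    using bdd_measurable_on_add[OF hinge'[OF s(1)] bdd_measurable_on_mult[OF const[of "- k"] hinge'[OF h(1)]]]
    by (simp add: \<phi>'_def)
  have hinge_deriv: "(hinge \<Gamma> p has_real_derivative (if r < p then 0 else r powr (1 - M))) (at r)"
    if "0 < p" "0 < r" "r \<noteq> p" for p r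
  proof (cases "r < p")
    case True
    have "(hinge \<Gamma> p has_real_derivative 0) (at r)"
      by (rule has_field_derivative_transform_within_open[where S="{..<p}" and f="\<lambda>_. 0"])
        (use True in \<open>auto simp: hinge_def\<close>)
    then show ?thesis using True by simp
  next
    case False
    have "((\<lambda>r. \<Gamma> r - \<Gamma> p) has_real_derivative r powr (1 - M) - 0) (at r)"
      using that by (intro DERIV_diff \<Gamma>_deriv DERIV_const)
    then have "(hinge \<Gamma> p has_real_derivative r powr (1 - M) - 0) (at r)"
      by (rule has_field_derivative_transform_within_open[where S="{p<..}"])
        (use False that in \<open>auto simp: hinge_def\<close>)
    then show ?thesis using False that by simp
  qed
  show wd: "has_weak_deriv01 \<phi> \<phi>'"
  proof (rule has_weak_deriv01_piecewise[OF \<phi>_cont, of "{s, h}"])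
    fix x assume "x \<in> {0<..<1} - {s, h}"
    then show "(\<phi> has_real_derivative \<phi>' x) (at x)"
      unfolding \<phi>_def \<phi>'_def using s h
      by (intro DERIV_diff DERIV_cmult hinge_deriv) auto
  qed (auto intro: bdd_measurable_on_absolutely_integrable \<phi>'_bm)
  have sub: "bdd_measurable_on {m..1} f" if "bdd_measurable_on {0..1} f" for f
    using that m by (rule_tac bdd_measurable_on_subset) auto
  have weighted: "integrable I01 (\<lambda>r. r powr c * (f r)\<^sup>2)"
    if "bdd_measurable_on {0..1} f" "\<And>r. r < m \<Longrightarrow> f r = 0" for c f
  proof (rule integral_I01_bdd_measurable(1))
    have "continuous_on {m..1} (\<lambda>r. r powr c)"
      using m by (intro continuous_intros) auto
    then show "bdd_measurable_on {m..1} (\<lambda>r. r powr c * (f r)\<^sup>2)"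
      unfolding power2_eq_square
      by (intro bdd_measurable_on_mult sub that bdd_measurable_on_continuous)
  qed (use m that in auto)
  have "\<phi> \<in> borel_measurable I01"
    by (intro continuous_imp_measurable_on_sets_lebesgue continuous_on_subset[OF \<phi>_cont]) auto
  moreover have "integrable I01 (\<lambda>r. r powr c * (\<phi> r)\<^sup>2)" for c
    by (intro weighted bdd_measurable_on_continuous \<phi>_cont) (use m in \<open>auto simp: \<phi>_def hinge_def\<close>)
  moreover have "integrable I01 (\<lambda>r. r powr c * (\<phi>' r)\<^sup>2)" for c
    by (intro weighted \<phi>'_bm) (use m in \<open>auto simp: \<phi>'_def\<close>)
  moreover have "continuous_on {0<..1} \<phi>"
    by (rule continuous_on_subset[OF \<phi>_cont]) auto
  moreover have "\<phi> 1 = 0"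
    using s h k by (simp add: \<phi>_def hinge_def \<Gamma>_1)
  ultimately show "\<phi> \<in> calH_0 M"
    using wd by (auto simp: calH_0_def H1_0_def)
qed

end

section \<open>Integrating weak derivatives up to the endpoint 1\<close>

text \<open>On \<open>[s,1]\<close> the inverse weight is bounded by some \<open>D\<close>, so
  \<open>\<bar>g\<bar> \<le> 1 + g^2\<close> is dominated by
  \<open>1 + D * r powr c * g^2\<close>.\<close>

lemma weighted_L2_absolutely_integrable:
  assumes g: "g \<in> borel_measurable I01" and L2: "integrable I01 (\<lambda>r. r powr c * (g r)\<^sup>2)"
    and s: "0 < s" "s < 1"
  shows "g absolutely_integrable_on {s..1}"
proof -
  have "bounded ((\<lambda>r. r powr (- c)) ` {s..1})"
    using s by (intro compact_imp_bounded compact_continuous_image continuous_intros) auto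
  then obtain D where D: "D > 0" "\<And>r. r \<in> {s..1} \<Longrightarrow> \<bar>r powr (- c)\<bar> \<le> D"
    by (auto simp: bounded_pos)
  have "integrable I01 (\<lambda>r. 1 + D * (r powr c * (g r)\<^sup>2))"
    using L2 integral_I01_eq(1)[OF absolutely_integrable_continuous_real, of "\<lambda>_. 1"] by auto
  then have dom: "(\<lambda>r. 1 + D * (r powr c * (g r)\<^sup>2)) integrable_on {0<..<1}"
    by (rule integrable_on_lebesgue_on) auto
  have "(\<lambda>r. if r < s then 0 else g r) absolutely_integrable_on {0<..<1}"
  proof (rule measurable_bounded_by_integrable_imp_absolutely_integrable[OF _ _ dom])
    have "indicat_real {s..} \<in> borel_measurable I01"
      by (intro measurable_restrict_space1 borel_measurable_indicator) auto
    then have "(\<lambda>r. indicat_real {s..} r * g r) \<in> borel_measurable I01"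
      using g by (rule borel_measurable_times)
    also have "(\<lambda>r. indicat_real {s..} r * g r) = (\<lambda>r. if r < s then 0 else g r)"
      by (auto simp: fun_eq_iff indicator_def)
    finally show "(\<lambda>r. if r < s then 0 else g r) \<in> borel_measurable I01" .
    fix r :: real assume r: "r \<in> {0<..<1}"
    show "norm (if r < s then 0 else g r) \<le> 1 + D * (r powr c * (g r)\<^sup>2)"
    proof (cases "r < s")
      case False
      have "\<bar>g r\<bar> \<le> 1 + (g r)\<^sup>2"
        using zero_le_power2[of "\<bar>g r\<bar> - 1"] by (simp add: power2_diff)
      also have "(g r)\<^sup>2 = r powr (- c) * (r powr c * (g r)\<^sup>2)"
        using r by (simp add: powr_minus)
      also have "\<dots> \<le> D * (r powr c * (g r)\<^sup>2)"
        using D(2)[of r] r False by (intro mult_right_mono) auto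
      finally show ?thesis using False by simp
    qed (use D in auto)
  qed auto
  then have "(\<lambda>r. if r < s then 0 else g r) absolutely_integrable_on {s<..<1}"
    by (rule set_integrable_subset) (use s in auto)
  then have "g absolutely_integrable_on {s<..<1}"
    by (rule set_integrable_cong[THEN iffD1, rotated -1]) auto
  then show ?thesis
    using absolutely_integrable_on_open_interval[where f=g and a=s and b=1] by simp
qed

text \<open>Both sides of the interior formula are continuous in the upper limit \<open>t\<close> up
  to \<open>t = 1\<close>, so the identity extends to the closure.\<close>

lemma weak_deriv_FTC_1:
  assumes wd: "has_weak_deriv01 v g" and v: "continuous_on {0<..1} v"
    and g: "g absolutely_integrable_on {s..1}" and s: "0 < s" "s < 1"
  shows "v 1 - v s = integral {s..1} g"
proof -
  have "v 1 - v s - integral {s..1} g = 0"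
  proof (rule continuous_constant_on_closure[where S="{s<..<1}" and x=1 and
        f="\<lambda>t. v t - v s - integral {s..t} g"])
    have "continuous_on {s..1} (\<lambda>t. integral {s..t} g)"
      using g set_lebesgue_integral_eq_integral(1) indefinite_integral_continuous_1 by blast
    then show "continuous_on (closure {s<..<1}) (\<lambda>t. v t - v s - integral {s..t} g)"
      using s by (auto intro!: continuous_intros continuous_on_subset[OF v])
    have v': "continuous_on {0<..<1} v"
      by (rule continuous_on_subset[OF v]) auto
    show "v t - v s - integral {s..t} g = 0" if "t \<in> {s<..<1}" for t
      using weak_deriv_FTC[OF wd v'] s that by simp
    show "1 \<in> closure {s<..<1}"
      using s by simp
  qed
  then show ?thesis by simp
qed

subsection \<open>Green representation of weak solutions\<close>

text \<open>The right-hand side \<open>q\<close> when the equation is written as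
  \<open>- (r powr (M - 1) * \<psi>')' = q\<close>.\<close>

definition source :: "real \<Rightarrow> (real \<Rightarrow> real) \<Rightarrow> real \<Rightarrow> (real \<Rightarrow> real) \<Rightarrow> real \<Rightarrow> real" where
  "source M a \<nu> \<psi> r = r powr (M - 1) * (a r * \<psi> r) + \<nu> * (r powr (M - 3) * \<psi> r)"

lemma continuous_on_powr_const:
  "0 < m \<Longrightarrow> continuous_on {m..n} (\<lambda>r::real. r powr c)"
  by (intro continuous_intros) auto

context
  fixes a0 :: "real \<Rightarrow> real" and C :: real
  assumes a0_meas: "a0 \<in> borel_measurable lebesgue" and a0_bd: "\<And>r. \<bar>a0 r\<bar> \<le> C"
begin

lemma bdd_measurable_on_a0: "bdd_measurable_on S a0"
  using a0_bd a0_meas by (auto simp: bdd_measurable_on_def bounded_iff measurable_restrict_space1)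

lemma bdd_measurable_on_source:
  assumes "continuous_on {0<..1} \<psi>" "0 < m"
  shows "bdd_measurable_on {m..1} (source M a0 \<nu> \<psi>)"
proof -
  have "continuous_on {m..1} \<psi>"
    by (rule continuous_on_subset[OF assms(1)]) (use assms(2) in auto)
  then show ?thesis
    unfolding source_def[abs_def] using assms(2)
    by (intro bdd_measurable_on_add bdd_measurable_on_mult bdd_measurable_on_a0
        bdd_measurable_on_continuous continuous_on_powr_const continuous_on_const)
qed

lemma continuous_integral_source:
  assumes "continuous_on {0<..1} \<psi>" "x \<in> {0<..1}"
  shows "continuous (at x within {0<..1}) (\<lambda>s. integral {s..1} (source M a0 \<nu> \<psi>))"
proof -
  define m where "m = x / 2"
  have m: "0 < m" "m < x" "x \<le> 1" using assms(2) by (auto simp: m_def)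
  have q: "source M a0 \<nu> \<psi> integrable_on {m..1}"
    by (intro set_lebesgue_integral_eq_integral(1) bdd_measurable_on_absolutely_integrable
        bdd_measurable_on_source assms m)
  have "continuous_on {m..1} (\<lambda>s. integral {m..1} (source M a0 \<nu> \<psi>) - integral {m..s} (source M a0 \<nu> \<psi>))"
    by (intro continuous_intros indefinite_integral_continuous_1 q)
  also have "?this \<longleftrightarrow> continuous_on {m..1} (\<lambda>s. integral {s..1} (source M a0 \<nu> \<psi>))"
    by (rule continuous_on_cong)
      (use Henstock_Kurzweil_Integration.integral_combine[OF _ _ q] in \<open>auto simp: algebra_simps\<close>)
  finally show ?thesis
    using m by (simp add: at_within_01_eq[OF m] continuous_on_eq_continuous_within)
qed

context
  fixes M :: real and \<Gamma> a :: "real \<Rightarrow> real"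
  assumes \<Gamma>_deriv: "\<And>r. r > 0 \<Longrightarrow> (\<Gamma> has_real_derivative r powr (1 - M)) (at r)"
    and \<Gamma>_1: "\<Gamma> 1 = 0"
    and a_meas: "a \<in> borel_measurable I01" and a_a0: "AE r in I01. a r = a0 r"
begin

text \<open>The terms of the weak equation are evaluated for each hinge separately, as a hinge alone
  is not admissible. The weight cancels the derivative of the hinge, so the leading term is
  \<open>integral {s..1} g = \<psi> 1 - \<psi> s = - \<psi> s\<close>.\<close>

lemma hinge_pairing:
  assumes \<psi>: "\<psi> \<in> calH_0 M" and g: "has_weak_deriv01 \<psi> g"
    and g_L2: "integrable I01 (\<lambda>r. r powr (M - 1) * (g r)\<^sup>2)" and s: "0 < s" "s < 1"
  shows "integrable I01 (\<lambda>r. r powr (M - 1) * (g r * (if r < s then 0 else r powr (1 - M))))"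
    and "(LINT r|I01. r powr (M - 1) * (g r * (if r < s then 0 else r powr (1 - M)))) = - \<psi> s"
    and "integrable I01 (\<lambda>r. r powr (M - 1) * (a r * \<psi> r * hinge \<Gamma> s r))"
    and "integrable I01 (\<lambda>r. r powr (M - 3) * (\<psi> r * hinge \<Gamma> s r))"
    and "(LINT r|I01. r powr (M - 1) * (a r * \<psi> r * hinge \<Gamma> s r))
        + \<nu> * (LINT r|I01. r powr (M - 3) * (\<psi> r * hinge \<Gamma> s r))
      = integral {s..1} (\<lambda>r. source M a0 \<nu> \<psi> r * (\<Gamma> r - \<Gamma> s))"
proof -
  have \<psi>_cont: "continuous_on {0<..1} \<psi>" and \<psi>_1: "\<psi> 1 = 0"
    and \<psi>_meas: "\<psi> \<in> borel_measurable I01"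
    using \<psi> by (auto simp: calH_0_def H1_0_def)
  have "g \<in> borel_measurable I01"
    using g by (intro locally_L1_01_measurable) (simp add: has_weak_deriv01_def)
  then have g_ai: "g absolutely_integrable_on {s..1}"
    using g_L2 s by (rule weighted_L2_absolutely_integrable)
  have powr_cancel: "r powr (M - 1) * (y * r powr (1 - M)) = y" if "0 < r" for r y
    using that by (simp add: powr_diff field_simps)
  note cutoff = integral_I01_cutoff[OF g_ai s(1) order_refl,
      of "\<lambda>r. r powr (M - 1) * (g r * (if r < s then 0 else r powr (1 - M)))"]
  show "integrable I01 (\<lambda>r. r powr (M - 1) * (g r * (if r < s then 0 else r powr (1 - M))))"
    by (rule cutoff(1)) (auto simp: powr_cancel)
  have "(LINT r|I01. r powr (M - 1) * (g r * (if r < s then 0 else r powr (1 - M)))) = integral {s..1} g"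
    by (rule cutoff(2)) (auto simp: powr_cancel)
  then show "(LINT r|I01. r powr (M - 1) * (g r * (if r < s then 0 else r powr (1 - M)))) = - \<psi> s"
    using weak_deriv_FTC_1[OF g \<psi>_cont g_ai s] \<psi>_1 by simp
  have hinge_meas: "hinge \<Gamma> s \<in> borel_measurable I01"
    by (intro continuous_imp_measurable_on_sets_lebesgue
        continuous_on_subset[OF continuous_on_hinge[OF \<Gamma>_deriv s(1)]]) auto
  have powr_meas: "(\<lambda>r. r powr c) \<in> borel_measurable I01" for c :: real
    by (intro continuous_imp_measurable_on_sets_lebesgue continuous_intros) auto
  have \<psi>_cont_s: "continuous_on {s..1} \<psi>" and \<Gamma>_cont_s: "continuous_on {s..1} (\<lambda>r. \<Gamma> r - \<Gamma> s)"
    using s by (auto intro!: continuous_intros continuous_on_\<Gamma>[OF \<Gamma>_deriv] continuous_on_subset[OF \<psi>_cont])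
  let ?f2 = "\<lambda>r. r powr (M - 1) * (a0 r * \<psi> r * (\<Gamma> r - \<Gamma> s))"
  let ?f3 = "\<lambda>r. r powr (M - 3) * (\<psi> r * (\<Gamma> r - \<Gamma> s))"
  have bm2: "bdd_measurable_on {s..1} ?f2"
    using s by (intro bdd_measurable_on_mult bdd_measurable_on_a0 bdd_measurable_on_continuous
        continuous_on_powr_const \<psi>_cont_s \<Gamma>_cont_s)
  have bm3: "bdd_measurable_on {s..1} ?f3"
    using s by (intro bdd_measurable_on_mult bdd_measurable_on_continuous
        continuous_on_powr_const \<psi>_cont_s \<Gamma>_cont_s)
  note int = set_lebesgue_integral_eq_integral(1)[OF bdd_measurable_on_absolutely_integrable]
  let ?h2 = "\<lambda>r. r powr (M - 1) * (a0 r * \<psi> r * hinge \<Gamma> s r)"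
  let ?h2a = "\<lambda>r. r powr (M - 1) * (a r * \<psi> r * hinge \<Gamma> s r)"
  let ?h3 = "\<lambda>r. r powr (M - 3) * (\<psi> r * hinge \<Gamma> s r)"
  have h2: "integrable I01 ?h2" "(LINT r|I01. ?h2 r) = integral {s..1} ?f2"
    by (rule integral_I01_bdd_measurable[OF bm2 s(1)]; force simp: hinge_def)+
  show h3: "integrable I01 ?h3"
    by (rule integral_I01_bdd_measurable[OF bm3 s(1)]; force simp: hinge_def)
  have h3': "(LINT r|I01. ?h3 r) = integral {s..1} ?f3"
    by (rule integral_I01_bdd_measurable[OF bm3 s(1)]; force simp: hinge_def)
  have h2a_meas: "?h2a \<in> borel_measurable I01"
    using a_meas \<psi>_meas hinge_meas powr_meas by (intro borel_measurable_times)
  \<comment> \<open>The weak equation contains \<open>a\<close>, while \<open>source\<close> is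
    formed with its bounded representative \<open>a0\<close>; the integrals agree.\<close>
  have AE: "AE r in I01. ?h2 r = ?h2a r"
    using a_a0 by eventually_elim simp
  show "integrable I01 ?h2a"
    by (rule integrable_cong_AE_imp[OF h2(1) h2a_meas AE])
  have "(LINT r|I01. ?h2a r) = (LINT r|I01. ?h2 r)"
    using AE h2a_meas h2(1) by (intro Bochner_Integration.integral_cong_AE) auto
  moreover have "integral {s..1} ?f2 + \<nu> * integral {s..1} ?f3 =
      integral {s..1} (\<lambda>r. ?f2 r + \<nu> * ?f3 r)"
    using Henstock_Kurzweil_Integration.integral_add[OF int[OF bm2] integrable_on_mult_right[OF int[OF bm3]], of \<nu>]
    by simp
  moreover have "?f2 r + \<nu> * ?f3 r = source M a0 \<nu> \<psi> r * (\<Gamma> r - \<Gamma> s)" for r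
    by (simp add: source_def algebra_simps)
  ultimately show "(LINT r|I01. ?h2a r) + \<nu> * (LINT r|I01. ?h3 r) =
      integral {s..1} (\<lambda>r. source M a0 \<nu> \<psi> r * (\<Gamma> r - \<Gamma> s))"
    using h2 h3' by simp
qed

text \<open>The defect \<open>E s\<close> of the equation for the hinge at \<open>s\<close> need not
  vanish, but testing with a difference of hinges gives
  \<open>E s = \<Gamma> s / \<Gamma> h * E h\<close>. Hence \<open>E\<close> is a multiple of
  \<open>\<Gamma>\<close>, and \<open>c = - E h / \<Gamma> h\<close>.\<close>

lemma weak_solution_representation:
  assumes sol: "weak_solution M a \<nu> \<psi>"
  obtains c where "\<And>s. s \<in> {0<..1} \<Longrightarrow>
    \<psi> s = c * \<Gamma> s - integral {s..1} (\<lambda>r. source M a0 \<nu> \<psi> r * (\<Gamma> r - \<Gamma> s))"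
proof -
  have \<psi>: "\<psi> \<in> calH_0 M"
    using sol by (simp add: weak_solution_def)
  then have \<psi>_1: "\<psi> 1 = 0"
    by (simp add: calH_0_def H1_0_def)
  obtain g where g: "has_weak_deriv01 \<psi> g"
    and g_L2: "integrable I01 (\<lambda>r. r powr (M - 1) * (g r)\<^sup>2)"
    using \<psi> by (auto simp: calH_0_def H1_0_def)
  note pairing = hinge_pairing[OF \<psi> g g_L2]
  \<comment> \<open>An arbitrary reference point in \<open>(0,1)\<close>; there
    \<open>\<Gamma> h < \<Gamma> 1 = 0\<close> because \<open>\<Gamma>\<close> is strictly
    increasing.\<close>
  define h :: real where "h = 1 / 2"
  have h: "0 < h" "h < 1" by (auto simp: h_def)
  have "\<Gamma> h < \<Gamma> 1"
  proof (rule DERIV_pos_imp_increasing[OF h(2)])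
    fix x assume "h \<le> x" "x \<le> 1"
    then show "\<exists>y. DERIV \<Gamma> x :> y \<and> 0 < y"
      using \<Gamma>_deriv[of x] h by (intro exI[of _ "x powr (1 - M)"]) auto
  qed
  then have \<Gamma>_h: "\<Gamma> h \<noteq> 0"
    using \<Gamma>_1 by simp
  \<comment> \<open>Left side minus right side of the weak equation, evaluated formally at the
    single hinge.\<close>
  define E where "E s = - \<psi> s - integral {s..1} (\<lambda>r. source M a0 \<nu> \<psi> r * (\<Gamma> r - \<Gamma> s))" for s
  have E: "E s = \<Gamma> s / \<Gamma> h * E h" if s: "0 < s" "s < 1" for s
  proof -
    define k where "k = \<Gamma> s / \<Gamma> h"
    have k: "k * \<Gamma> h = \<Gamma> s"
      using \<Gamma>_h by (simp add: k_def)
    let ?h' = "\<lambda>s r. if r < s then 0 else r powr (1 - M)"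
    let ?A = "\<lambda>s r. r powr (M - 1) * (g r * ?h' s r)"
    let ?B = "\<lambda>s r. r powr (M - 1) * (a r * \<psi> r * hinge \<Gamma> s r)"
    let ?C = "\<lambda>s r. r powr (M - 3) * (\<psi> r * hinge \<Gamma> s r)"
    note int_s = pairing(1,3,4)[OF s] and int_h = pairing(1,3,4)[OF h]
    have weak: "(LINT r|I01. r powr (M - 1) * (g r * (?h' s r - k * ?h' h r)
          - a r * \<psi> r * (hinge \<Gamma> s r - k * hinge \<Gamma> h r))) =
        \<nu> * (LINT r|I01. r powr (M - 3) * \<psi> r * (hinge \<Gamma> s r - k * hinge \<Gamma> h r))"
      using sol g hinge_difference_in_calH_0[OF \<Gamma>_deriv \<Gamma>_1 s h k]
      unfolding weak_solution_def by blast
    have "(LINT r|I01. r powr (M - 1) * (g r * (?h' s r - k * ?h' h r)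
          - a r * \<psi> r * (hinge \<Gamma> s r - k * hinge \<Gamma> h r))) =
        (LINT r|I01. (?A s r - k * ?A h r) - (?B s r - k * ?B h r))"
      by (intro Bochner_Integration.integral_cong refl) (simp only: algebra_simps)
    also have "\<dots> = ((LINT r|I01. ?A s r) - k * (LINT r|I01. ?A h r))
        - ((LINT r|I01. ?B s r) - k * (LINT r|I01. ?B h r))"
      using int_s int_h by (simp del: mult_if_delta)
    finally have lhs: "(LINT r|I01. r powr (M - 1) * (g r * (?h' s r - k * ?h' h r)
          - a r * \<psi> r * (hinge \<Gamma> s r - k * hinge \<Gamma> h r))) =
        (- \<psi> s - k * - \<psi> h) - ((LINT r|I01. ?B s r) - k * (LINT r|I01. ?B h r))"
      by (simp only: pairing(2)[OF s] pairing(2)[OF h])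
    have "(LINT r|I01. r powr (M - 3) * \<psi> r * (hinge \<Gamma> s r - k * hinge \<Gamma> h r)) =
        (LINT r|I01. ?C s r - k * ?C h r)"
      by (intro Bochner_Integration.integral_cong refl) (simp only: algebra_simps)
    also have "\<dots> = (LINT r|I01. ?C s r) - k * (LINT r|I01. ?C h r)"
      using int_s int_h by simp
    finally have rhs: "(LINT r|I01. r powr (M - 3) * \<psi> r * (hinge \<Gamma> s r - k * hinge \<Gamma> h r)) =
        (LINT r|I01. ?C s r) - k * (LINT r|I01. ?C h r)" .
    have linear: "- p - (bs + \<nu> * cs) = k * (- q - (bh + \<nu> * ch))"
      if "(- p - k * - q) - (bs - k * bh) = \<nu> * (cs - k * ch)" for p q bs bh cs ch :: real
      using that by (simp add: algebra_simps)
    have "E s = k * E h"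
      unfolding E_def pairing(5)[OF s, of \<nu>, symmetric] pairing(5)[OF h, of \<nu>, symmetric]
      using weak unfolding lhs rhs by (rule linear)
    then show ?thesis
      by (simp add: k_def)
  qed
  show thesis
  proof
    fix s :: real assume "s \<in> {0<..1}"
    then consider "0 < s" "s < 1" | "s = 1" by fastforce
    then show "\<psi> s = - E h / \<Gamma> h * \<Gamma> s - integral {s..1} (\<lambda>r. source M a0 \<nu> \<psi> r * (\<Gamma> r - \<Gamma> s))"
    proof cases
      case 1
      have "\<psi> s = - E s - integral {s..1} (\<lambda>r. source M a0 \<nu> \<psi> r * (\<Gamma> r - \<Gamma> s))"
        by (simp add: E_def)
      then show ?thesis
        by (simp add: E[OF 1])
    next
      case 2
      then show ?thesis
        by (simp add: \<psi>_1 \<Gamma>_1)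
    qed
  qed
qed

text \<open>In the Green integral \<open>s\<close> is both the lower limit and a parameter.
  Splitting \<open>\<Gamma> r - \<Gamma> s\<close> as
  \<open>(\<Gamma> r - \<Gamma> x) - (\<Gamma> s - \<Gamma> x)\<close> gives an integral whose
  integrand is continuous and zero at \<open>x\<close>, hence with derivative 0 there, and a product
  whose first factor vanishes at \<open>x\<close>.\<close>

lemma weak_solution_deriv:
  assumes sol: "weak_solution M a \<nu> \<psi>"
  obtains c where "\<And>x. x \<in> {0<..1} \<Longrightarrow>
    (\<psi> has_real_derivative x powr (1 - M) * (c + integral {x..1} (source M a0 \<nu> \<psi>))) (at x within {0<..1})"
proof -
  have \<psi>_cont: "continuous_on {0<..1} \<psi>"
    using sol by (auto simp: weak_solution_def calH_0_def H1_0_def)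
  let ?q = "source M a0 \<nu> \<psi>"
  obtain c where rep: "\<And>s. s \<in> {0<..1} \<Longrightarrow> \<psi> s = c * \<Gamma> s - integral {s..1} (\<lambda>r. ?q r * (\<Gamma> r - \<Gamma> s))"
    using weak_solution_representation[OF sol] by blast
  show thesis
  proof
    fix x :: real assume x: "x \<in> {0<..1}"
    define m where "m = x / 2"
    have m: "0 < m" "m < x" "x \<le> 1" using x by (auto simp: m_def)
    let ?G = "\<lambda>r. \<Gamma> r - \<Gamma> x"
    have q_bm: "bdd_measurable_on {p..1} ?q" if "0 < p" for p
      by (intro bdd_measurable_on_source \<psi>_cont that)
    have qG_bm: "bdd_measurable_on {p..1} (\<lambda>r. ?q r * ?G r)" if "0 < p" for p
      using that
      by (intro bdd_measurable_on_mult q_bm bdd_measurable_on_continuous continuous_intros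
          continuous_on_\<Gamma>[OF \<Gamma>_deriv]) auto
    note int = set_lebesgue_integral_eq_integral(1)[OF bdd_measurable_on_absolutely_integrable]
    have \<Gamma>x: "(?G has_real_derivative x powr (1 - M)) (at x within {0<..1})"
      using DERIV_diff[OF \<Gamma>_deriv[of x] DERIV_const[of "\<Gamma> x"]] m
      by (auto intro: has_field_derivative_at_within)
    then have "continuous (at x within {m..1}) ?G"
      using m by (auto simp: at_within_01_eq[OF m] intro: DERIV_continuous)
    moreover obtain B where "\<And>r. r \<in> {m..1} \<Longrightarrow> \<bar>?q r\<bar> \<le> B"
      using q_bm[OF m(1)] by (auto simp: bdd_measurable_on_def bounded_iff simp del: atLeastAtMost_iff)
    ultimately have "continuous (at x within {m..1}) (\<lambda>r. ?q r * ?G r)"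
      by (intro continuous_bounded_mult_vanishing) auto
    then have "((\<lambda>s. integral {s..1} (\<lambda>r. ?q r * ?G r)) has_real_derivative - (?q x * ?G x))
        (at x within {0<..1})"
      by (intro integral_upper_has_real_derivative[OF m int[OF qG_bm[OF m(1)]]])
    then have 1: "((\<lambda>s. integral {s..1} (\<lambda>r. ?q r * ?G r)) has_real_derivative 0) (at x within {0<..1})"
      by simp
    have 2: "((\<lambda>s. ?G s * integral {s..1} ?q) has_real_derivative x powr (1 - M) * integral {x..1} ?q)
        (at x within {0<..1})"
      by (intro has_real_derivative_mult_vanishing \<Gamma>x continuous_integral_source \<psi>_cont x) simp
    have 3: "((\<lambda>s. c * \<Gamma> s) has_real_derivative c * x powr (1 - M)) (at x within {0<..1})"
      using m by (intro DERIV_cmult has_field_derivative_at_within[OF \<Gamma>_deriv]) auto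
    have "((\<lambda>s. c * \<Gamma> s - integral {s..1} (\<lambda>r. ?q r * ?G r) + ?G s * integral {s..1} ?q)
        has_real_derivative c * x powr (1 - M) - 0 + x powr (1 - M) * integral {x..1} ?q)
        (at x within {0<..1})"
      by (intro DERIV_add DERIV_diff 1 2 3)
    then have "(\<psi> has_real_derivative c * x powr (1 - M) - 0 + x powr (1 - M) * integral {x..1} ?q)
        (at x within {0<..1})"
    proof (rule has_field_derivative_transform_within[OF _ zero_less_one x])
      fix s :: real assume s: "s \<in> {0<..1}"
      have "integral {s..1} (\<lambda>r. ?q r * ?G r) - ?G s * integral {s..1} ?q =
          integral {s..1} (\<lambda>r. ?q r * ?G r - ?G s * ?q r)"
        using s int[OF qG_bm[of s]] int[OF q_bm[of s]]
        by (subst Henstock_Kurzweil_Integration.integral_diff) (auto intro!: integrable_on_mult_right)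
      also have "(\<lambda>r. ?q r * ?G r - ?G s * ?q r) = (\<lambda>r. ?q r * (\<Gamma> r - \<Gamma> s))"
        by (simp add: fun_eq_iff algebra_simps)
      finally show "c * \<Gamma> s - integral {s..1} (\<lambda>r. ?q r * ?G r) + ?G s * integral {s..1} ?q = \<psi> s"
        using rep[OF s] by simp
    qed
    then show "(\<psi> has_real_derivative x powr (1 - M) * (c + integral {x..1} ?q)) (at x within {0<..1})"
      by (simp add: algebra_simps)
  qed
qed

end

end

subsection \<open>The Wronskian\<close>

text \<open>Used with \<open>c = 1 - M\<close>; the logarithmic case \<open>c = - 1\<close> is
  \<open>M = 2\<close>.\<close>

lemma powr_antiderivative:
  obtains \<Gamma> :: "real \<Rightarrow> real" where
    "\<And>r. r > 0 \<Longrightarrow> (\<Gamma> has_real_derivative r powr c) (at r)" "\<Gamma> 1 = 0"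
proof (cases "c = - 1")
  case True
  show thesis
    by (rule that[of ln]) (auto intro!: derivative_eq_intros simp: True powr_minus_divide)
next
  case False
  show thesis
  proof
    fix r :: real assume r: "r > 0"
    have "((\<lambda>r. (r powr (c + 1) - 1) / (c + 1)) has_real_derivative
        ((c + 1) * r powr (c + 1 - 1) - 0) / (c + 1)) (at r)"
      by (intro DERIV_cdivide DERIV_diff DERIV_const has_real_derivative_powr r)
    then show "((\<lambda>r. (r powr (c + 1) - 1) / (c + 1)) has_real_derivative r powr c) (at r)"
      using False by (simp add: add_eq_0_iff2)
  qed simp
qed

text \<open>Truncating at the essential bound changes \<open>a\<close> only on a null set of
  \<open>(0,1)\<close>. The pointwise bound supports continuity arguments at every single
  point.\<close>

lemma Linfty01_bounded_representative:
  assumes "a \<in> Linfty01"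
  obtains a0 C where "a0 \<in> borel_measurable lebesgue" "\<And>r. \<bar>a0 r\<bar> \<le> C" "AE r in I01. a r = a0 r"
proof -
  obtain C where C: "AE r in I01. \<bar>a r\<bar> \<le> C" and a: "a \<in> borel_measurable I01"
    using assms by (auto simp: Linfty01_def)
  define a0 where "a0 r = max (- \<bar>C\<bar>) (min \<bar>C\<bar> (if r \<in> {0<..<1} then a r else 0))" for r
  have "(\<lambda>r. if r \<in> {0<..<1} then a r else 0) \<in> borel_measurable lebesgue"
    by (rule borel_measurable_if_I[OF a]) auto
  then have "a0 \<in> borel_measurable lebesgue"
    unfolding a0_def[abs_def] by measurable
  moreover have "\<bar>a0 r\<bar> \<le> \<bar>C\<bar>" for r
    by (auto simp: a0_def)
  moreover have "AE r in I01. a r = a0 r"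
    using C AE_space[of I01]
    by eventually_elim (auto simp: a0_def space_restrict_space)
  ultimately show thesis by (rule that)
qed

text \<open>Freezing \<open>u\<close> and \<open>v\<close> at \<open>x\<close> leaves the remainder
  \<open>(v s - v x) * P s - (u s - u x) * Q s\<close>, whose derivative at \<open>x\<close> is
  \<open>G * Q x * P x - G * P x * Q x = 0\<close>. Here \<open>P\<close> and \<open>Q\<close> play
  the role of the fluxes and \<open>G\<close> that of the inverse weight.\<close>

lemma wronskian_has_real_derivative:
  fixes u v P Q :: "real \<Rightarrow> real"
  assumes u: "(u has_real_derivative G * P x) (at x within S)"
    and v: "(v has_real_derivative G * Q x) (at x within S)"
    and P: "continuous (at x within S) P" and Q: "continuous (at x within S) Q"
    and frozen: "((\<lambda>s. P s * v x - u x * Q s) has_real_derivative D) (at x within S)"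
  shows "((\<lambda>s. P s * v s - u s * Q s) has_real_derivative D) (at x within S)"
proof -
  have "((\<lambda>s. (v s - v x) * P s) has_real_derivative G * Q x * P x) (at x within S)"
    using DERIV_diff[OF v DERIV_const[of "v x"]]
    by (intro has_real_derivative_mult_vanishing P) auto
  moreover have "((\<lambda>s. (u s - u x) * Q s) has_real_derivative G * P x * Q x) (at x within S)"
    using DERIV_diff[OF u DERIV_const[of "u x"]]
    by (intro has_real_derivative_mult_vanishing Q) auto
  ultimately have "((\<lambda>s. (P s * v x - u x * Q s) + ((v s - v x) * P s - (u s - u x) * Q s))
      has_real_derivative D + (G * Q x * P x - G * P x * Q x)) (at x within S)"
    by (intro DERIV_add DERIV_diff frozen)
  then show ?thesis
    by (simp add: algebra_simps)
qed

text \<open>In the integrand \<open>f\<close> the coefficient \<open>a\<close> is multiplied by a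
  combination of \<open>\<psi>i r\<close> and \<open>\<psi>j r\<close> that is zero at
  \<open>r = x\<close>. So \<open>f\<close> is continuous at \<open>x\<close> whatever
  \<open>a\<close> does there, and only the terms with \<open>\<nu>i\<close> and
  \<open>\<nu>j\<close> contribute to \<open>f x\<close>.\<close>

lemma wronskian_source_deriv:
  assumes \<psi>i: "continuous_on {0<..1} \<psi>i" and \<psi>j: "continuous_on {0<..1} \<psi>j"
    and a: "a \<in> borel_measurable lebesgue" "\<And>r. \<bar>a r\<bar> \<le> C" and x: "x \<in> {0<..1}"
  shows "((\<lambda>s. (ci + integral {s..1} (source M a \<nu>i \<psi>i)) * \<psi>j x
          - \<psi>i x * (cj + integral {s..1} (source M a \<nu>j \<psi>j)))
      has_real_derivative x powr (M - 3) * (\<nu>j - \<nu>i) * \<psi>i x * \<psi>j x) (at x within {0<..1})"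
proof -
  define m where "m = x / 2"
  have m: "0 < m" "m < x" "x \<le> 1" using x by (auto simp: m_def)
  let ?qi = "source M a \<nu>i \<psi>i" and ?qj = "source M a \<nu>j \<psi>j"
  note int = set_lebesgue_integral_eq_integral(1)[OF bdd_measurable_on_absolutely_integrable
      [OF bdd_measurable_on_source[OF a]]]
  have qi: "?qi integrable_on {p..1}" and qj: "?qj integrable_on {p..1}" if "0 < p" for p
    using that \<psi>i \<psi>j by (auto intro: int)
  define f where "f r = \<psi>j x * ?qi r - \<psi>i x * ?qj r" for r
  have f_int: "f integrable_on {p..1}" if "0 < p" for p
    unfolding f_def[abs_def]
    by (intro integrable_diff integrable_on_mult_right qi qj that)
  have f_eq: "f = (\<lambda>r. a r * (r powr (M - 1) * (\<psi>j x * \<psi>i r - \<psi>i x * \<psi>j r))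
      + r powr (M - 3) * (\<nu>i * \<psi>j x * \<psi>i r - \<nu>j * \<psi>i x * \<psi>j r))"
    by (simp add: fun_eq_iff f_def source_def algebra_simps)
  have within: "continuous (at x within {m..1}) h" if "continuous_on {m..1} h" for h :: "real \<Rightarrow> real"
    using that m by (simp add: continuous_on_eq_continuous_within)
  have \<psi>: "continuous_on {m..1} \<psi>i" "continuous_on {m..1} \<psi>j"
    using m by (auto intro: continuous_on_subset[OF \<psi>i] continuous_on_subset[OF \<psi>j])
  have "continuous (at x within {m..1}) f"
    unfolding f_eq
    by (intro continuous_add continuous_bounded_mult_vanishing[OF a(2)] within
        continuous_intros continuous_on_powr_const \<psi> m) simp
  then have "((\<lambda>s. integral {s..1} f) has_real_derivative - f x) (at x within {0<..1})"
    by (rule integral_upper_has_real_derivative[OF m f_int[OF m(1)]])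
  then have "((\<lambda>s. (ci * \<psi>j x - \<psi>i x * cj) + integral {s..1} f) has_real_derivative 0 + - f x)
      (at x within {0<..1})"
    by (intro DERIV_add DERIV_const)
  moreover have "0 + - f x = x powr (M - 3) * (\<nu>j - \<nu>i) * \<psi>i x * \<psi>j x"
    by (simp add: f_eq algebra_simps)
  ultimately have "((\<lambda>s. (ci * \<psi>j x - \<psi>i x * cj) + integral {s..1} f) has_real_derivative
      x powr (M - 3) * (\<nu>j - \<nu>i) * \<psi>i x * \<psi>j x) (at x within {0<..1})"
    by simp
  then show ?thesis
  proof (rule has_field_derivative_transform_within[OF _ zero_less_one x])
    fix s :: real assume "s \<in> {0<..1}"
    then have "integral {s..1} f = \<psi>j x * integral {s..1} ?qi - \<psi>i x * integral {s..1} ?qj"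
      unfolding f_def[abs_def]
      by (subst Henstock_Kurzweil_Integration.integral_diff) (auto intro!: qi qj integrable_on_mult_right)
    then show "(ci * \<psi>j x - \<psi>i x * cj) + integral {s..1} f =
        (ci + integral {s..1} ?qi) * \<psi>j x - \<psi>i x * (cj + integral {s..1} ?qj)"
      by (simp add: algebra_simps)
  qed
qed

theorem lemma3p13:
  fixes M \<nu>i \<nu>j :: real and a \<psi>i \<psi>j :: "real \<Rightarrow> real"
  assumes "M \<ge> 2"
    and "a \<in> Linfty01"
    and "weak_solution M a \<nu>i \<psi>i"
    and "weak_solution M a \<nu>j \<psi>j"
  shows "C1_on01 \<psi>i \<and> C1_on01 \<psi>j \<and>
    (\<forall>r\<in>{0<..1}.
      ((\<lambda>s. s powr (M - 1) * (deriv01 \<psi>i s * \<psi>j s - \<psi>i s * deriv01 \<psi>j s))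
        has_real_derivative r powr (M - 3) * (\<nu>j - \<nu>i) * \<psi>i r * \<psi>j r)
        (at r within {0<..1})) \<and>
    (\<forall>r\<in>{0<..1}. \<psi>j r \<noteq> 0 \<longrightarrow>
      ((\<lambda>s. s powr (M - 1) * (deriv01 \<psi>i s * \<psi>j s - \<psi>i s * deriv01 \<psi>j s) * (\<psi>i s / \<psi>j s))
        has_real_derivative
          r powr (M - 3) * (\<nu>j - \<nu>i) * (\<psi>i r)\<^sup>2
          + r powr (M - 1) * (deriv01 \<psi>i r - deriv01 \<psi>j r * (\<psi>i r / \<psi>j r))\<^sup>2)
        (at r within {0<..1}))"
proof -
  obtain \<Gamma> where \<Gamma>: "\<And>r. r > 0 \<Longrightarrow> (\<Gamma> has_real_derivative r powr (1 - M)) (at r)" "\<Gamma> 1 = 0"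
    using powr_antiderivative by blast
  have a: "a \<in> borel_measurable I01"
    using assms(2) by (simp add: Linfty01_def)
  obtain a0 C where a0: "a0 \<in> borel_measurable lebesgue" "\<And>r. \<bar>a0 r\<bar> \<le> C" "AE r in I01. a r = a0 r"
    using Linfty01_bounded_representative[OF assms(2)] by blast
  \<comment> \<open>The flux \<open>s powr (M - 1) * \<psi>' s\<close>; its continuity gives that of
    \<open>deriv01 \<psi>\<close>.\<close>
  let ?P = "\<lambda>c \<nu> \<psi> s. c + integral {s..1} (source M a0 \<nu> \<psi>)"
  have regular: "\<exists>c. (\<forall>x\<in>{0<..1}. (\<psi> has_real_derivative x powr (1 - M) * ?P c \<nu> \<psi> x) (at x within {0<..1}) \<and>
        deriv01 \<psi> x = x powr (1 - M) * ?P c \<nu> \<psi> x \<and>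
        continuous (at x within {0<..1}) (?P c \<nu> \<psi>)) \<and> C1_on01 \<psi>"
    if sol: "weak_solution M a \<nu> \<psi>" for \<nu> \<psi>
  proof -
    obtain c where c: "\<And>x. x \<in> {0<..1} \<Longrightarrow>
        (\<psi> has_real_derivative x powr (1 - M) * ?P c \<nu> \<psi> x) (at x within {0<..1})"
      using weak_solution_deriv[OF a0(1,2) \<Gamma> a a0(3) sol] by blast
    then have d: "deriv01 \<psi> x = x powr (1 - M) * ?P c \<nu> \<psi> x" if "x \<in> {0<..1}" for x
      using that by (intro deriv01_eqI)
    have "continuous_on {0<..1} \<psi>"
      using sol by (auto simp: weak_solution_def calH_0_def H1_0_def)
    then have cont: "continuous (at x within {0<..1}) (?P c \<nu> \<psi>)" if "x \<in> {0<..1}" for x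
      by (intro continuous_intros continuous_integral_source[OF a0(1,2)] that)
    then have "continuous_on {0<..1} (?P c \<nu> \<psi>)"
      by (simp add: continuous_on_eq_continuous_within)
    then have "continuous_on {0<..1} (\<lambda>x. x powr (1 - M) * ?P c \<nu> \<psi> x)"
      by (intro continuous_on_mult) (auto intro!: continuous_intros)
    also have "?this \<longleftrightarrow> continuous_on {0<..1} (deriv01 \<psi>)"
      by (rule continuous_on_cong) (auto simp: d)
    finally have "C1_on01 \<psi>"
      using c d by (auto simp: C1_on01_def)
    then show ?thesis
      using c d cont by blast
  qed
  obtain ci where i: "\<And>x. x \<in> {0<..1} \<Longrightarrow> (\<psi>i has_real_derivative x powr (1 - M) * ?P ci \<nu>i \<psi>i x) (at x within {0<..1})"
    "\<And>x. x \<in> {0<..1} \<Longrightarrow> deriv01 \<psi>i x = x powr (1 - M) * ?P ci \<nu>i \<psi>i x"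
    "\<And>x. x \<in> {0<..1} \<Longrightarrow> continuous (at x within {0<..1}) (?P ci \<nu>i \<psi>i)" "C1_on01 \<psi>i"
    using regular[OF assms(3)] by blast
  obtain cj where j: "\<And>x. x \<in> {0<..1} \<Longrightarrow> (\<psi>j has_real_derivative x powr (1 - M) * ?P cj \<nu>j \<psi>j x) (at x within {0<..1})"
    "\<And>x. x \<in> {0<..1} \<Longrightarrow> deriv01 \<psi>j x = x powr (1 - M) * ?P cj \<nu>j \<psi>j x"
    "\<And>x. x \<in> {0<..1} \<Longrightarrow> continuous (at x within {0<..1}) (?P cj \<nu>j \<psi>j)" "C1_on01 \<psi>j"
    using regular[OF assms(4)] by blast
  let ?W = "\<lambda>s. s powr (M - 1) * (deriv01 \<psi>i s * \<psi>j s - \<psi>i s * deriv01 \<psi>j s)"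
  have cont: "continuous_on {0<..1} \<psi>i" "continuous_on {0<..1} \<psi>j"
    using assms(3,4) by (auto simp: weak_solution_def calH_0_def H1_0_def)
  have W: "(?W has_real_derivative x powr (M - 3) * (\<nu>j - \<nu>i) * \<psi>i x * \<psi>j x) (at x within {0<..1})"
    if x: "x \<in> {0<..1}" for x
  proof -
    have "((\<lambda>s. ?P ci \<nu>i \<psi>i s * \<psi>j s - \<psi>i s * ?P cj \<nu>j \<psi>j s) has_real_derivative
        x powr (M - 3) * (\<nu>j - \<nu>i) * \<psi>i x * \<psi>j x) (at x within {0<..1})"
      by (rule wronskian_has_real_derivative[OF i(1)[OF x] j(1)[OF x] i(3)[OF x] j(3)[OF x]
            wronskian_source_deriv[OF cont a0(1,2) x]])
    then show ?thesis
    proof (rule has_field_derivative_transform_within[OF _ zero_less_one x])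
      fix s :: real assume s: "s \<in> {0<..1}"
      \<comment> \<open>The weight and its inverse cancel, so \<open>?W\<close> is the Wronskian
        expressed in the fluxes.\<close>
      have cancel: "s powr (M - 1) * (s powr (1 - M) * p * v - u * (s powr (1 - M) * q)) = p * v - u * q"
        for p q u v
        using s by (simp add: powr_diff field_simps)
      show "?P ci \<nu>i \<psi>i s * \<psi>j s - \<psi>i s * ?P cj \<nu>j \<psi>j s = ?W s"
        by (simp only: i(2)[OF s] j(2)[OF s] cancel)
    qed
  qed
  have "((\<lambda>s. ?W s * (\<psi>i s / \<psi>j s)) has_real_derivative
      r powr (M - 3) * (\<nu>j - \<nu>i) * (\<psi>i r)\<^sup>2
        + r powr (M - 1) * (deriv01 \<psi>i r - deriv01 \<psi>j r * (\<psi>i r / \<psi>j r))\<^sup>2) (at r within {0<..1})"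
    if r: "r \<in> {0<..1}" and nz: "\<psi>j r \<noteq> 0" for r
  proof -
    have "(\<psi>i has_real_derivative deriv01 \<psi>i r) (at r within {0<..1})"
      "(\<psi>j has_real_derivative deriv01 \<psi>j r) (at r within {0<..1})"
      using i(4) j(4) r by (auto simp: C1_on01_def)
    \<comment> \<open>The square arises from \<open>?W r\<close> times the derivative of the
      quotient: \<open>r powr (M - 1) * (\<psi>i' * \<psi>j - \<psi>i * \<psi>j')^2 /
      \<psi>j^2\<close>, and dividing inside the square by \<open>\<psi>j\<close> gives the stated
      form.\<close>
    from DERIV_mult[OF W[OF r] DERIV_divide[OF this nz]]
    show ?thesis
      by (rule DERIV_cong) (use nz in \<open>simp add: field_simps power2_eq_square\<close>)
  qed
  then show ?thesis
    using i(4) j(4) W by blast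
qed

end
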